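(* Let $X\ge0$ be a random variable with $\mathrm{Var}(X)\in(0,\infty)$ such that both $X^s$ and $X^z$ exist. Let $\lambda>0$ and $W\sim\mathrm{CP}(\lambda,\mathscr{L}(X))$ with $\mu=\mathbb{E}W$ and $\sigma^2=\mathrm{Var}(W)$. Put $\alpha=\mu/\sigma^2$, $r=\mu^2/\sigma^2$ and $\Theta=d_{\mathrm W}(\mathscr{L}(X^s),\mathscr{L}(\tilde X))$, where $\tilde X$ has density $$f_{\tilde X}(y)=\frac{1}{\mathbb{E}(X^2)}\mathbb{E}\left[X\mathbf{1}_{\{X\ge y\}}\right],\qquad y\ge0.$$ Then $$d_{\mathrm W}(\mathscr{L}(W),\Gamma(r,\alpha))\le 8\sqrt{\frac{3\mu}{r+2}}\,\Theta^{1/2}+\frac{8r}{r+2}\Theta,\qquad d_{\mathrm K}(\mathscr{L}(W),\Gamma(r,\alpha))\le a_{r,\alpha}\,\Theta^{\frac{r\wedge 1}{r\wedge 1+2}}+b_{r,\alpha}\,\Theta^{\frac{r\wedge 1+1}{r\wedge 1+2}}.$$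
   Context: $\mathscr{L}(X)$ is the law of $X$; $a\wedge b=\min(a,b)$; $0^0=1$. $\mathrm{CP}(\lambda,\mathscr{L}(X))$ is the distribution of $\sum_{i=1}^NX_i$, where $X_1,X_2,\dots$ are i.i.d. copies of $X$ independent of the Poisson random variable $N$ with mean $\lambda$. $\Gamma(r,\alpha)$ is the distribution with density $\frac{1}{\Gamma(r)}\alpha^r x^{r-1}e^{-\alpha x}$, $x>0$. The constants are $$a_{r,\alpha}=\begin{cases}\left(\frac12+\frac1r\right)\left(\frac{48\mu}{r+2}\right)^{\frac{r}{r+2}}\left[\frac{\alpha^r}{\Gamma(r)}\right]^{\frac{2}{r+2}},&0<r<1,\\[4pt] 3\left(\frac{6\mu}{r+2}\right)^{1/3}\left[\frac{\alpha}{\Gamma(r)}\left(\frac{r-1}{e}\right)^{r-1}\right]^{2/3},&r\ge1,\end{cases}$$ $$b_{r,\alpha}=\begin{cases}8\alpha\left(\frac{\mu}{r+2}\right)^{\frac{r+1}{r+2}}\left[\frac{\alpha^r}{48\,\Gamma(r)}\right]^{\frac{1}{r+2}},&0<r<1,\\[4pt] 4\alpha\left(\frac{\mu}{r+2}\right)^{2/3}\left[\frac{\alpha}{6\,\Gamma(r)}\left(\frac{r-1}{e}\right)^{r-1}\right]^{1/3},&r\ge1.\end{cases}$$ $d_{\mathrm W}(\mathscr{L}(X),\mathscr{L}(Y))=\sup_{f}|\mathbb{E}f(X)-\mathbb{E}f(Y)|$ over all $f:\mathbb{R}\to\mathbb{R}$ with $|f(x)-f(y)|\le|x-y|$ for all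 $x,y\in\mathbb{R}$ (understood as $+\infty$ if exactly one of the laws has infinite first absolute moment, in which case bounds in terms of it are trivial). $d_{\mathrm K}(\mathscr{L}(X),\mathscr{L}(Y))=\sup_{z\in\mathbb{R}}|\mathbb{P}(X\le z)-\mathbb{P}(Y\le z)|$. Size bias: for a nonnegative random variable $V$ with finite mean $\mu_V>0$, $V^s$ has the $V$-size biased distribution if $\mathbb{E}[Vf(V)]=\mu_V\,\mathbb{E}f(V^s)$ for all functions $f$ with $\mathbb{E}|Vf(V)|<\infty$. Zero bias: for a random variable $V$ with mean $\mu_V$ and variance $\sigma_V^2\in(0,\infty)$, $V^z$ has the $V$-zero biased distribution if $\mathbb{E}[(V-\mu_V)f(V)]=\sigma_V^2\,\mathbb{E}f'(V^z)$ for all differentiable functions $f$ with $\mathbb{E}|Vf(V)|<\infty$ and for which $\mathbb{E}|f'(V^z)|<\infty$. *)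

theory Defs
  imports "HOL-Probability.Probability"
begin

text \<open>Throughout, the law of a real random variable \<open>X\<close> on \<open>M\<close> is \<open>distr M borel X\<close>, and
  distances and biased distributions are formulated for laws.\<close>

text \<open>If exactly one of the laws has infinite first absolute moment, the distance is \<open>\<infinity>\<close>. If
  both have a finite first moment, every 1-Lipschitz function is integrable with respect to both
  laws, so the integrability constraints below are vacuous; they only matter
  when both first moments are infinite.\<close>

definition wasserstein_dist :: "real measure \<Rightarrow> real measure \<Rightarrow> ennreal" where
  "wasserstein_dist P Q =
    (if integrable P (\<lambda>x. x) \<noteq> integrable Q (\<lambda>x. x) then \<infinity>
     else (SUP f\<in>{f. (\<forall>x y. \<bar>f x - f y\<bar> \<le> \<bar>x - y\<bar>) \<and> integrable P f \<and> integrable Q f}.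
             ennreal \<bar>(\<integral>x. f x \<partial>P) - (\<integral>x. f x \<partial>Q)\<bar>))"

definition kolmogorov_dist :: "real measure \<Rightarrow> real measure \<Rightarrow> ennreal" where
  "kolmogorov_dist P Q = (SUP z. ennreal \<bar>cdf P z - cdf Q z\<bar>)"

definition size_biased :: "real measure \<Rightarrow> real measure \<Rightarrow> bool" where
  "size_biased P S \<longleftrightarrow> real_distribution S \<and>
    (\<forall>f\<in>borel_measurable borel. integrable P (\<lambda>v. v * f v) \<longrightarrow>
       integrable S f \<and> (\<integral>v. v * f v \<partial>P) = (\<integral>v. v \<partial>P) * (\<integral>v. f v \<partial>S))"

definition zero_biased :: "real measure \<Rightarrow> real measure \<Rightarrow> bool" where
  "zero_biased P Z \<longleftrightarrow> real_distribution Z \<and>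
    (\<forall>f. (\<forall>x. f field_differentiable (at x)) \<longrightarrow>
       integrable P (\<lambda>v. v * f v) \<longrightarrow> integrable Z (deriv f) \<longrightarrow>
       (\<integral>v. (v - (\<integral>u. u \<partial>P)) * f v \<partial>P) =
         prob_space.variance P (\<lambda>v. v) * (\<integral>v. deriv f v \<partial>Z))"

text \<open>The product space carries independent coordinates: a Poisson variable \<open>n\<close> with mean \<open>l\<close> and
  an i.i.d. sequence \<open>x 0, x 1, \<dots>\<close> with common law \<open>P\<close>.\<close>

definition compound_poisson :: "real \<Rightarrow> real measure \<Rightarrow> real measure" where
  "compound_poisson l P =
    distr (measure_pmf (poisson_pmf l) \<Otimes>\<^sub>M PiM UNIV (\<lambda>_::nat. P)) borel
      (\<lambda>(n, x). \<Sum>i<n. x i)"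

definition gamma_dist :: "real \<Rightarrow> real \<Rightarrow> real measure" where
  "gamma_dist r \<alpha> = density lborel
    (\<lambda>x. ennreal (if x > 0 then 1 / Gamma r * \<alpha> powr r * x powr (r - 1) * exp (- \<alpha> * x) else 0))"

definition tilde_dist :: "real measure \<Rightarrow> real measure" where
  "tilde_dist P = density lborel
    (\<lambda>y. ennreal (if y \<ge> 0
       then 1 / (\<integral>x. x\<^sup>2 \<partial>P) * (\<integral>x. x * indicator {y..} x \<partial>P) else 0))"

text \<open>The convention \<open>0 ^ 0 = 1\<close> is needed at \<open>r = 1\<close>, whereas \<open>0 powr 0 = 0\<close> in the library.\<close>

definition mode_factor :: "real \<Rightarrow> real" where
  "mode_factor r = (if r = 1 then 1 else ((r - 1) / exp 1) powr (r - 1))"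

definition a_const :: "real \<Rightarrow> real \<Rightarrow> real \<Rightarrow> real" where
  "a_const \<mu> r \<alpha> =
    (if r < 1
     then (1/2 + 1/r) * (48 * \<mu> / (r + 2)) powr (r / (r + 2))
            * (\<alpha> powr r / Gamma r) powr (2 / (r + 2))
     else 3 * (6 * \<mu> / (r + 2)) powr (1/3) * (\<alpha> / Gamma r * mode_factor r) powr (2/3))"

definition b_const :: "real \<Rightarrow> real \<Rightarrow> real \<Rightarrow> real" where
  "b_const \<mu> r \<alpha> =
    (if r < 1
     then 8 * \<alpha> * (\<mu> / (r + 2)) powr ((r + 1) / (r + 2))
            * (\<alpha> powr r / (48 * Gamma r)) powr (1 / (r + 2))
     else 4 * \<alpha> * (\<mu> / (r + 2)) powr (2/3) * (\<alpha> / (6 * Gamma r) * mode_factor r) powr (1/3))"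

text \<open>Real powers on the extended nonnegative reals, meant for exponents \<open>p > 0\<close>.\<close>

definition ennreal_powr :: "ennreal \<Rightarrow> real \<Rightarrow> ennreal" where
  "ennreal_powr t p = (if t = \<infinity> then \<infinity> else ennreal (enn2real t powr p))"

end

theory Submission
  imports Defs "HOL-Real_Asymp.Real_Asymp"
begin

text \<open>
  Stein's method. For \<open>W\<close> compound Poisson with summand law \<open>\<L>(X)\<close> one has
  \<open>\<E>[W g(W)] = \<mu> \<E>[g(W + X\<^sup>s)]\<close> with \<open>X\<^sup>s\<close> independent of \<open>W\<close>, and averaging the increment
  \<open>f(W + X\<^sup>s) - f(W)\<close> produces the density of \<open>X\<close>-tilde, so that
  \<open>\<E>[W f'(W) + (r - \<alpha> W) f(W)]\<close> is \<open>\<mu>\<close> times the difference of \<open>\<E> f'(W + \<sqdot>)\<close> at \<open>X\<^sup>s\<close> and at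
  \<open>X\<close>-tilde, hence at most \<open>\<mu> \<parallel>f''\<parallel> \<Theta>\<close>. For the solution \<open>f\<close> of the gamma Stein equation
  \<open>x f' + (r - \<alpha> x) f = h - \<E> h(\<Gamma>)\<close>, differentiating once and twice gives equations of the same
  kind with shape \<open>r + 1\<close> and \<open>r + 2\<close>; maximum principles for these yield
  \<open>(r + 2) \<parallel>f''\<parallel> \<le> 2 \<parallel>h''\<parallel> + 4 \<alpha> \<parallel>h'\<parallel>\<close>. Rough test functions are averaged twice over small
  intervals, and the smoothing width is optimised at the end.
\<close>

section \<open>The gamma Stein equation\<close>

text \<open>The law of \<open>W\<close> has an atom at \<open>0\<close>, of mass at least
  \<open>exp (- l)\<close>, so the Stein equation is needed at \<open>0\<close> as well; this is why
  \<open>f\<close> has to be regular across \<open>0\<close>. The parameters are forced. The mean of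
  \<open>X^s\<close> is \<open>\<E> X^2 / \<E> X = \<sigma>2 / \<mu> = 1 / \<alpha>\<close>, and it
  is the factor between the average of the integral of \<open>f'(w + t)\<close> over
  \<open>0 \<le> t \<le> X^s\<close> and \<open>\<E> f'(w + \<sqdot>)\<close> at
  \<open>X\<close>-tilde. With \<open>r = \<alpha> \<mu>\<close> the terms in \<open>f\<close> then
  cancel. The main obstacle is the unbounded domain: the maximum principles apply only to functions
  already known to be bounded, whereas a solution of the equation may grow exponentially. Centring
  \<open>h\<close> at its gamma mean rules this out. Bounds with unspecified constants for
  \<open>f\<close>, \<open>f'\<close> and \<open>f''\<close> therefore precede the sharp ones. The
  factor \<open>r + 2 - \<alpha> x\<close> vanishes inside the half-line, so an estimate of
  \<open>(r + 2 - \<alpha> x) f''\<close> alone does not bound \<open>f''\<close>. An estimate of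
  \<open>x f''\<close>, from the equation of shape \<open>r + 1\<close>, fills the gap; hence both
  \<open>h'\<close> and \<open>h''\<close> enter.\<close>

lemma second_derivative_nonpos_at_max:
  fixes y y' :: "real \<Rightarrow> real"
  assumes y: "\<And>x. x > 0 \<Longrightarrow> (y has_real_derivative y' x) (at x)"
    and y': "(y' has_real_derivative c) (at s)"
    and s: "s > 0" and max: "\<And>x. x > 0 \<Longrightarrow> y x \<le> y s"
  shows "y' s = 0" "c \<le> 0"
proof -
  show z: "y' s = 0"
    by (rule DERIV_local_max[OF y[OF s] s]) (use max s in \<open>auto simp: abs_if split: if_splits\<close>)
  show "c \<le> 0"
  proof (rule ccontr)
    assume "\<not> c \<le> 0"
    then obtain d where d: "d > 0" "\<And>h. h > 0 \<Longrightarrow> h < d \<Longrightarrow> y' s < y' (s + h)"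
      using DERIV_pos_inc_right[OF y'] by auto
    \<comment> \<open>If \<open>c\<close> were positive, \<open>y'\<close> would be positive just to
      the right of its zero \<open>s\<close>, and \<open>y\<close> would climb above its
      maximum.\<close>
    have "y s < y (s + d/2)"
    proof (rule DERIV_pos_imp_increasing_open[where f = y])
      show "s < s + d/2" using d by simp
      fix x assume x: "s < x" "x < s + d/2"
      then have "y' x > 0" using d(2)[of "x - s"] z by auto
      moreover have "(y has_real_derivative y' x) (at x)" using y[of x] s x by auto
      ultimately show "\<exists>l. (y has_real_derivative l) (at x) \<and> 0 < l" by blast
    next
      show "continuous_on {s..s + d/2} y"
        by (rule DERIV_continuous_on[where D = y'])
           (use y s in \<open>auto intro: has_field_derivative_at_within\<close>)
    qed
    with max[of "s + d/2"] s d show False by auto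
  qed
qed

text \<open>The perturbation \<open>x - ln x\<close> is a Lyapunov function of the operator
  \<open>v \<mapsto> x v'' + (\<rho> - \<alpha> x) v'\<close> at both ends of \<open>(0, \<infinity>)\<close>, which forces the maximum to be attained.\<close>

lemma laguerre_maximum_principle:
  fixes v v' v'' q :: "real \<Rightarrow> real"
  assumes v: "\<And>x. x > 0 \<Longrightarrow> (v has_real_derivative v' x) (at x)"
    and v': "\<And>x. x > 0 \<Longrightarrow> (v' has_real_derivative v'' x) (at x)"
    and eq: "\<And>x. x > 0 \<Longrightarrow> x * v'' x + (\<rho> - \<alpha> * x) * v' x - \<beta> * v x = q x"
    and q: "\<And>x. x > 0 \<Longrightarrow> - Q \<le> q x" and bd: "\<And>x. x > 0 \<Longrightarrow> v x \<le> B"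
    and pos: "\<rho> \<ge> 1" "\<alpha> > 0" "\<beta> > 0" "x0 > 0"
  shows "v x0 \<le> Q / \<beta>"
proof -
  define \<psi> :: "real \<Rightarrow> real" where "\<psi> x = x - ln x" for x
  have psi0: "\<psi> x \<ge> 0" if "x > 0" for x
    using ln_le_minus_one[OF that] by (simp add: \<psi>_def)
  have key: "v x0 \<le> Q / \<beta> + \<eta> * ((\<rho> + \<alpha>) / \<beta> + \<psi> x0)" if eta: "\<eta> > 0" for \<eta>
  proof -
    define y where "y x = v x - \<eta> * \<psi> x" for x
    define y' where "y' x = v' x - \<eta> * (1 - 1 / x)" for x
    have y: "(y has_real_derivative y' x) (at x)" if "x > 0" for x
      unfolding y_def y'_def \<psi>_def using that
      by (auto intro!: derivative_eq_intros v)
    have y': "(y' has_real_derivative v'' x - \<eta> / x\<^sup>2) (at x)" if "x > 0" for x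
      unfolding y'_def using that
      by (auto intro!: derivative_eq_intros v' simp: power2_eq_square)
    \<comment> \<open>Where \<open>\<psi> x \<ge> R\<close>, the bound \<open>B\<close> and the
      penalty give \<open>y x \<le> y x0\<close>. This covers neighbourhoods of both ends, so the
      maximum over a compact interval containing \<open>x0\<close> is global.\<close>
    define R where "R = (B - y x0) / \<eta>"
    have out: "y x \<le> y x0" if "x > 0" "\<psi> x \<ge> R" for x
    proof -
      have "\<eta> * \<psi> x \<ge> B - y x0"
        using that eta by (simp add: R_def field_simps)
      with bd[OF that(1)] show ?thesis by (simp add: y_def)
    qed
    have "eventually (\<lambda>x. \<psi> x \<ge> R) at_top" unfolding \<psi>_def
      by (rule filterlim_at_top[THEN iffD1, rule_format]) real_asymp
    then obtain b where b: "\<And>x. x \<ge> b \<Longrightarrow> \<psi> x \<ge> R" by (auto simp: eventually_at_top_linorder)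
    have "eventually (\<lambda>x. \<psi> x \<ge> R) (at_right 0)" unfolding \<psi>_def
      by (rule filterlim_at_top[THEN iffD1, rule_format]) real_asymp
    then obtain a where a: "a > 0" "\<And>x. x > 0 \<Longrightarrow> x < a \<Longrightarrow> \<psi> x \<ge> R"
      by (auto simp: eventually_at_right_field)
    define a' b' where "a' = min x0 a" and "b' = max x0 b"
    have ab: "a' > 0" "x0 \<in> {a'..b'}" using a pos by (auto simp: a'_def b'_def)
    have "continuous_on {a'..b'} y"
      by (rule DERIV_continuous_on[where D = y'])
         (use y ab in \<open>auto intro: has_field_derivative_at_within\<close>)
    then obtain s where s: "s \<in> {a'..b'}" "\<And>x. x \<in> {a'..b'} \<Longrightarrow> y x \<le> y s"
      using continuous_attains_sup[of "{a'..b'}" y] ab by auto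
    have s0: "s > 0" using s ab by auto
    have max: "y x \<le> y s" if "x > 0" for x
    proof (cases "x \<in> {a'..b'}")
      case False
      then have "\<psi> x \<ge> R" using that a b by (auto simp: a'_def b'_def)
      with out[OF that this] s(2)[OF ab(2)] show ?thesis by simp
    qed (use s in auto)
    note m = second_derivative_nonpos_at_max[OF y y'[OF s0] s0 max]
    have v's: "v' s = \<eta> * (1 - 1 / s)" using m(1) by (simp add: y'_def)
    have "s * v'' s \<le> s * (\<eta> / s\<^sup>2)" using m(2) s0 by (intro mult_left_mono) auto
    also have "\<dots> = \<eta> / s" using s0 by (simp add: power2_eq_square)
    finally have "\<beta> * v s \<le> \<eta> / s + (\<rho> - \<alpha> * s) * (\<eta> * (1 - 1 / s)) + Q"
      using eq[OF s0] q[OF s0] v's by simp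
    \<comment> \<open>The bracket is the operator applied to \<open>\<psi>\<close>. Its singular
      term has the good sign because \<open>\<rho> \<ge> 1\<close>, which the shapes
      \<open>r + 1\<close> and \<open>r + 2\<close> satisfy for every \<open>r > 0\<close>.\<close>
    also have "\<dots> = \<eta> * (\<rho> + \<alpha> - \<alpha> * s - (\<rho> - 1) / s) + Q"
      using s0 by (simp add: field_simps)
    also have "\<dots> \<le> \<eta> * (\<rho> + \<alpha>) + Q"
    proof -
      have "\<alpha> * s \<ge> 0" "(\<rho> - 1) / s \<ge> 0" using pos s0 by auto
      then show ?thesis using eta by (intro add_right_mono mult_left_mono) auto
    qed
    finally have "v s \<le> (\<eta> * (\<rho> + \<alpha>) + Q) / \<beta>" using pos by (simp add: field_simps)
    moreover have "v x0 \<le> v s + \<eta> * \<psi> x0"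
    proof -
      have "\<eta> * \<psi> s \<ge> 0" using eta psi0[OF s0] by simp
      then show ?thesis using max[OF pos(4)] by (simp add: y_def)
    qed
    ultimately show ?thesis by (simp add: add_divide_distrib algebra_simps)
  qed
  show ?thesis
  proof (rule tendsto_lowerbound)
    show "((\<lambda>\<eta>. Q / \<beta> + \<eta> * ((\<rho> + \<alpha>) / \<beta> + \<psi> x0)) \<longlongrightarrow> Q / \<beta>) (at_right 0)"
      by (auto intro!: tendsto_eq_intros)
    show "\<forall>\<^sub>F \<eta> in at_right 0. v x0 \<le> Q / \<beta> + \<eta> * ((\<rho> + \<alpha>) / \<beta> + \<psi> x0)"
      using key by (auto simp: eventually_at_right_field intro!: exI[of _ 1])
  qed simp
qed

lemma laguerre_maximum_principle_abs:
  fixes v v' v'' q :: "real \<Rightarrow> real"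
  assumes v: "\<And>x. x > 0 \<Longrightarrow> (v has_real_derivative v' x) (at x)"
    and v': "\<And>x. x > 0 \<Longrightarrow> (v' has_real_derivative v'' x) (at x)"
    and eq: "\<And>x. x > 0 \<Longrightarrow> x * v'' x + (\<rho> - \<alpha> * x) * v' x - \<beta> * v x = q x"
    and q: "\<And>x. x > 0 \<Longrightarrow> \<bar>q x\<bar> \<le> Q" and bd: "\<And>x. x > 0 \<Longrightarrow> \<bar>v x\<bar> \<le> B"
    and pos: "\<rho> \<ge> 1" "\<alpha> > 0" "\<beta> > 0" "x0 > 0"
  shows "\<bar>v x0\<bar> \<le> Q / \<beta>"
proof -
  have "v x0 \<le> Q / \<beta>"
    by (rule laguerre_maximum_principle[OF v v' eq _ _ pos]) (use q bd in \<open>auto simp: abs_le_iff minus_le_iff\<close>)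
  moreover have "- v x0 \<le> Q / \<beta>"
  proof (rule laguerre_maximum_principle[of "\<lambda>x. - v x" "\<lambda>x. - v' x" "\<lambda>x. - v'' x" \<rho> \<alpha> \<beta> "\<lambda>x. - q x" Q B, OF _ _ _ _ _ pos])
    fix x :: real assume x: "x > 0"
    show "x * - v'' x + (\<rho> - \<alpha> * x) * - v' x - \<beta> * - v x = - q x"
      using eq[OF x] by (simp add: algebra_simps)
    show "- Q \<le> - q x" "- v x \<le> B" using q[OF x] bd[OF x] by auto
  qed (auto intro!: derivative_eq_intros v v')
  ultimately show ?thesis by (simp add: abs_le_iff)
qed

section \<open>First-order equations: integrating factor and comparison\<close>

text \<open>The weight \<open>t powr \<rho> * exp (- \<alpha> * t)\<close> is the integrating factor
  of \<open>x u' + (\<rho> - \<alpha> x) u\<close>; what remains in front of the operator is the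
  unnormalised gamma density of shape \<open>\<rho>\<close>.\<close>

lemma gamma_weight_deriv:
  fixes u :: "real \<Rightarrow> real"
  assumes "(u has_real_derivative u') (at x)" "x > 0"
  shows "((\<lambda>t. t powr \<rho> * exp (- \<alpha> * t) * u t) has_real_derivative
     x powr (\<rho> - 1) * exp (- \<alpha> * x) * (x * u' + (\<rho> - \<alpha> * x) * u x)) (at x)"
proof -
  have "x powr \<rho> = x powr (\<rho> - 1) * x" using assms(2) by (simp add: powr_diff)
  then show ?thesis
    by (auto intro!: derivative_eq_intros assms simp: algebra_simps)
qed

lemma gamma_weight_tendsto_0:
  fixes g :: "real \<Rightarrow> real"
  assumes bd: "\<And>x. x > 0 \<Longrightarrow> \<bar>g x\<bar> \<le> B" and pos: "\<rho> > 0" "\<alpha> > 0"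
  shows "((\<lambda>t. t powr \<rho> * exp (- \<alpha> * t) * g t) \<longlongrightarrow> 0) (at_right 0)"
    and "((\<lambda>t. t powr \<rho> * exp (- \<alpha> * t) * g t) \<longlongrightarrow> 0) at_top"
proof -
  have le: "norm (t powr \<rho> * exp (- \<alpha> * t) * g t) \<le> t powr \<rho> * exp (- \<alpha> * t) * B"
    if "t > 0" for t
    using bd[OF that] by (auto simp: abs_mult intro!: mult_left_mono)
  have "((\<lambda>t. t powr \<rho> * exp (- \<alpha> * t) * B) \<longlongrightarrow> 0) (at_right 0)"
    using pos by real_asymp
  then show "((\<lambda>t. t powr \<rho> * exp (- \<alpha> * t) * g t) \<longlongrightarrow> 0) (at_right 0)"
    by (rule Lim_null_comparison[rotated])
       (use le in \<open>auto simp: eventually_at_right_field intro!: exI[of _ 1]\<close>)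
  have "((\<lambda>t. t powr \<rho> * exp (- \<alpha> * t) * B) \<longlongrightarrow> 0) at_top"
    using pos by real_asymp
  then show "((\<lambda>t. t powr \<rho> * exp (- \<alpha> * t) * g t) \<longlongrightarrow> 0) at_top"
    by (rule Lim_null_comparison[rotated])
       (rule eventually_mono[OF eventually_gt_at_top[of 0]], rule le)
qed

text \<open>Comparison with the constant \<open>K / (\<rho> - \<alpha> x)\<close>: multiplied by the weight
  \<open>t\<^sup>\<rho> exp (- \<alpha> t)\<close> the difference is decreasing on the side of \<open>x\<close> away from \<open>\<rho> / \<alpha>\<close>.\<close>

lemma gamma_first_order_bound_upper:
  fixes u u' k :: "real \<Rightarrow> real"
  assumes u: "\<And>x. x > 0 \<Longrightarrow> (u has_real_derivative u' x) (at x)"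
    and eq: "\<And>x. x > 0 \<Longrightarrow> x * u' x + (\<rho> - \<alpha> * x) * u x = k x"
    and k: "\<And>x. x > 0 \<Longrightarrow> k x \<le> K" and K: "K \<ge> 0"
    and bd: "\<And>x. x > 0 \<Longrightarrow> \<bar>u x\<bar> \<le> B"
    and pos: "\<rho> > 0" "\<alpha> > 0" "x > 0"
  shows "(\<rho> - \<alpha> * x) * u x \<le> K"
proof (cases "\<rho> - \<alpha> * x = 0")
  case False
  define C where "C = K / (\<rho> - \<alpha> * x)"
  define D where "D t = t powr \<rho> * exp (- \<alpha> * t) * (u t - C)" for t
  have D: "(D has_real_derivative
      t powr (\<rho> - 1) * exp (- \<alpha> * t) * (k t - (\<rho> - \<alpha> * t) * C)) (at t)" if "t > 0" for t
  proof -
    have "((\<lambda>t. u t - C) has_real_derivative u' t) (at t)"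
      using that by (auto intro!: derivative_eq_intros u)
    moreover have "t * u' t + (\<rho> - \<alpha> * t) * (u t - C) = k t - (\<rho> - \<alpha> * t) * C"
      using eq[OF that] by (simp add: right_diff_distrib)
    ultimately show ?thesis
      unfolding D_def using gamma_weight_deriv[of "\<lambda>t. u t - C" "u' t" t \<rho> \<alpha>] that by simp
  qed
  have bdC: "\<bar>u t - C\<bar> \<le> B + \<bar>C\<bar>" if "t > 0" for t using bd[OF that] by linarith
  have dec: "D t \<le> D s" if st: "0 < s" "s \<le> t" and
    far: "\<And>z. s \<le> z \<Longrightarrow> z \<le> t \<Longrightarrow> (\<rho> - \<alpha> * z) / (\<rho> - \<alpha> * x) \<ge> 1" for s t
  proof (rule DERIV_nonpos_imp_nonincreasing[OF st(2)])
    fix z assume z: "s \<le> z" "z \<le> t"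
    have "(\<rho> - \<alpha> * z) * C = K * ((\<rho> - \<alpha> * z) / (\<rho> - \<alpha> * x))" by (simp add: C_def)
    also have "\<dots> \<ge> K * 1" using far[OF z] K by (intro mult_left_mono) auto
    finally have "k z - (\<rho> - \<alpha> * z) * C \<le> 0" using k[of z] z st by simp
    then have "z powr (\<rho> - 1) * exp (- \<alpha> * z) * (k z - (\<rho> - \<alpha> * z) * C) \<le> 0"
      by (auto intro!: mult_nonneg_nonpos)
    with D[of z] z st show "\<exists>y. (D has_real_derivative y) (at z) \<and> y \<le> 0" by auto
  qed
  consider "\<alpha> * x < \<rho>" | "\<alpha> * x > \<rho>" using False by linarith
  then show ?thesis
  proof cases
    case 1
    \<comment> \<open>Left of \<open>\<rho> / \<alpha>\<close> the information comes from
      \<open>0\<close>: \<open>D\<close> starts at the limit \<open>0\<close> and decreases up to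
      \<open>x\<close>.\<close>
    have "D x \<le> D t" if "0 < t" "t \<le> x" for t
      by (rule dec) (use 1 that pos in \<open>auto simp: field_simps\<close>)
    then have "\<forall>\<^sub>F t in at_right 0. D x \<le> D t"
      using pos by (auto simp: eventually_at_right_field intro!: exI[of _ x])
    moreover have "(D \<longlongrightarrow> 0) (at_right 0)"
      unfolding D_def by (rule gamma_weight_tendsto_0[OF bdC pos(1,2)])
    ultimately have "D x \<le> 0"
      by (intro tendsto_lowerbound[of D 0]) auto
    then have "u x \<le> C" using pos by (simp add: D_def mult_le_0_iff)
    then show ?thesis using 1 by (simp add: C_def field_simps)
  next
    case 2
    \<comment> \<open>Right of \<open>\<rho> / \<alpha>\<close> it comes from infinity:
      \<open>D\<close> decreases to \<open>0\<close> beyond \<open>x\<close>, so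
      \<open>u x \<ge> C\<close>, and multiplying by the negative number
      \<open>\<rho> - \<alpha> * x\<close> reverses the inequality.\<close>
    have "D t \<le> D x" if "x \<le> t" for t
      by (rule dec) (use 2 that pos in \<open>auto simp: field_simps intro: order.trans\<close>)
    then have "\<forall>\<^sub>F t in at_top. D t \<le> D x"
      by (auto simp: eventually_at_top_linorder)
    moreover have "(D \<longlongrightarrow> 0) (at_top)"
      unfolding D_def by (rule gamma_weight_tendsto_0[OF bdC pos(1,2)])
    ultimately have "D x \<ge> 0"
      by (intro tendsto_upperbound[of D 0]) auto
    then have "u x \<ge> C" using pos by (simp add: D_def zero_le_mult_iff mult_le_0_iff)
    then show ?thesis using 2 by (simp add: C_def field_simps)
  qed
qed (use K in simp)

lemma gamma_first_order_bound:
  fixes u u' k :: "real \<Rightarrow> real"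
  assumes u: "\<And>x. x > 0 \<Longrightarrow> (u has_real_derivative u' x) (at x)"
    and eq: "\<And>x. x > 0 \<Longrightarrow> x * u' x + (\<rho> - \<alpha> * x) * u x = k x"
    and k: "\<And>x. x > 0 \<Longrightarrow> \<bar>k x\<bar> \<le> K"
    and bd: "\<And>x. x > 0 \<Longrightarrow> \<bar>u x\<bar> \<le> B"
    and pos: "\<rho> > 0" "\<alpha> > 0" "x > 0"
  shows "\<bar>(\<rho> - \<alpha> * x) * u x\<bar> \<le> K"
proof -
  have K: "K \<ge> 0" using k[of 1] by simp
  have "(\<rho> - \<alpha> * x) * u x \<le> K"
    by (rule gamma_first_order_bound_upper[OF u eq _ K bd pos]) (use k in \<open>auto simp: abs_le_iff\<close>)
  moreover have "(\<rho> - \<alpha> * x) * - u x \<le> K"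
  proof (rule gamma_first_order_bound_upper[of "\<lambda>x. - u x" "\<lambda>x. - u' x" \<rho> \<alpha> "\<lambda>x. - k x", OF _ _ _ K _ pos])
    fix x :: real assume x: "x > 0"
    show "x * - u' x + (\<rho> - \<alpha> * x) * - u x = - k x"
      using eq[OF x] by (simp add: algebra_simps)
    show "- k x \<le> K" "\<bar>- u x\<bar> \<le> B" using k[OF x] bd[OF x] by auto
  qed (auto intro!: derivative_eq_intros u)
  ultimately show ?thesis by (simp add: abs_le_iff)
qed

text \<open>Substituting \<open>s = v\<^bsup>1/r\<^esup>\<close> in \<open>x\<^sup>-\<^sup>r exp (\<alpha> x) \<integral>\<^sub>0\<^sup>x t\<^bsup>r-1\<^esup> exp (- \<alpha> t) h t dt\<close> with \<open>t = s x\<close> removes the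
  singularity, so that the solution is twice continuously differentiable across \<open>0\<close>.\<close>

lemma gamma_stein_solution:
  fixes h h' h'' :: "real \<Rightarrow> real"
  assumes r: "r > 0"
    and h: "\<And>x. (h has_real_derivative h' x) (at x)"
    and h': "\<And>x. (h' has_real_derivative h'' x) (at x)"
    and cont: "continuous_on UNIV h''"
  obtains f f' f'' where
    "\<And>x. (f has_real_derivative f' x) (at x)"
    "\<And>x. (f' has_real_derivative f'' x) (at x)"
    "continuous_on UNIV f''"
    "\<And>x. x * f' x + (r - \<alpha> * x) * f x = h x"
proof -
  define w where "w v = v powr (1 / r)" for v :: real
  define E where "E x v = exp (\<alpha> * x * (1 - w v))" for x v
  \<comment> \<open>\<open>k0\<close> is the integrand after the substitution, whose Jacobian is the
    factor \<open>1 / r\<close> in \<open>f\<close>; \<open>k1\<close> and \<open>k2\<close> are its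
    first two derivatives in \<open>x\<close>. All are jointly continuous up to
    \<open>v = 0\<close>, so differentiation under the integral is allowed.\<close>
  define k0 where "k0 x v = E x v * h (w v * x)" for x v
  define k1 where "k1 x v = E x v * (\<alpha> * (1 - w v) * h (w v * x) + w v * h' (w v * x))" for x v
  define k2 where "k2 x v = E x v * ((\<alpha> * (1 - w v))\<^sup>2 * h (w v * x)
      + 2 * \<alpha> * (1 - w v) * w v * h' (w v * x) + (w v)\<^sup>2 * h'' (w v * x))" for x v
  have ch: "continuous_on UNIV h" using h by (meson DERIV_continuous_on has_field_derivative_at_within)
  have ch': "continuous_on UNIV h'" using h' by (meson DERIV_continuous_on has_field_derivative_at_within)
  have cw: "continuous_on {0..1} w" unfolding w_def using r
    by (intro continuous_on_powr' continuous_intros) auto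
  note [continuous_intros] = continuous_on_compose2[OF ch _ subset_UNIV]
    continuous_on_compose2[OF ch' _ subset_UNIV] continuous_on_compose2[OF cont _ subset_UNIV]
  have cw2: "continuous_on (UNIV \<times> {0..1}) (\<lambda>z::real \<times> real. w (snd z))"
    by (rule continuous_on_compose2[OF cw]) (auto intro!: continuous_intros)
  have c0: "continuous_on (UNIV \<times> {0..1}) (\<lambda>(x, v). k0 x v)"
   and c1: "continuous_on (UNIV \<times> {0..1}) (\<lambda>(x, v). k1 x v)"
   and c2: "continuous_on (UNIV \<times> {0..1}) (\<lambda>(x, v). k2 x v)"
    unfolding k0_def k1_def k2_def E_def split_beta by (intro continuous_intros cw2)+
  have sl: "continuous_on {0..1} (k x)"
    if "continuous_on (UNIV \<times> {0..1}) (\<lambda>(x, v). k x v)" for k :: "real \<Rightarrow> real \<Rightarrow> real" and x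
  proof -
    have "continuous_on {0..1} (\<lambda>v. case (x, v) of (x, v) \<Rightarrow> k x v)"
      by (rule continuous_on_compose2[OF that]) (auto intro!: continuous_on_Pair continuous_on_id continuous_on_const)
    then show ?thesis by simp
  qed
  have hw: "((\<lambda>x. h (w v * x)) has_real_derivative w v * h' (w v * x)) (at x)" for v x
  proof -
    have "((\<lambda>x. w v * x) has_real_derivative w v) (at x)" by (auto intro!: derivative_eq_intros)
    from DERIV_chain2[where g = "\<lambda>x. w v * x", OF h this] show ?thesis by (rule DERIV_cong) simp
  qed
  have hw': "((\<lambda>x. h' (w v * x)) has_real_derivative w v * h'' (w v * x)) (at x)" for v x
  proof -
    have "((\<lambda>x. w v * x) has_real_derivative w v) (at x)" by (auto intro!: derivative_eq_intros)
    from DERIV_chain2[where g = "\<lambda>x. w v * x", OF h' this] show ?thesis by (rule DERIV_cong) simp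
  qed
  have EE: "((\<lambda>x. E x v) has_real_derivative \<alpha> * (1 - w v) * E x v) (at x)" for v x
    unfolding E_def by (auto intro!: derivative_eq_intros)
  have d0: "((\<lambda>x. k0 x v) has_real_derivative k1 x v) (at x)" for x v
    unfolding k0_def k1_def
    by (rule DERIV_cong[OF DERIV_mult[OF EE hw]]) (simp add: algebra_simps)
  have d1: "((\<lambda>x. k1 x v) has_real_derivative k2 x v) (at x)" for x v
    unfolding k1_def k2_def
    by (rule DERIV_cong[OF DERIV_mult[OF EE DERIV_add[OF DERIV_cmult[OF hw] DERIV_cmult[OF hw']]]])
      (simp add: algebra_simps power2_eq_square)
  define f where "f x = integral {0..1} (k0 x) / r" for x
  define f' where "f' x = integral {0..1} (k1 x) / r" for x
  define f'' where "f'' x = integral {0..1} (k2 x) / r" for x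
  have f: "(f has_real_derivative f' x) (at x)" for x
    using leibniz_rule_field_derivative[of UNIV 0 1 k0 k1 x] d0 c1 sl[OF c0]
    unfolding f_def f'_def
    by (intro DERIV_cdivide) (auto intro!: integrable_continuous_interval)
  have f': "(f' has_real_derivative f'' x) (at x)" for x
    using leibniz_rule_field_derivative[of UNIV 0 1 k1 k2 x] d1 c2 sl[OF c1]
    unfolding f'_def f''_def
    by (intro DERIV_cdivide) (auto intro!: integrable_continuous_interval)
  have f'': "continuous_on UNIV f''"
    using integral_continuous_on_param[of UNIV 0 1 k2] c2 r
    unfolding f''_def by (intro continuous_intros) auto
  have eq: "x * f' x + (r - \<alpha> * x) * f x = h x" for x
  proof -
    \<comment> \<open>\<open>q\<close> is the derivative of \<open>v * k0 x v\<close> in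
      \<open>v\<close>. Integrated over the unit interval it gives \<open>k0 x 1 = h x\<close>, and
      rewritten through \<open>k1\<close> and \<open>k0\<close> it is the integrand of the left side
      of the Stein equation.\<close>
    define q where "q v = k0 x v + E x v * (w v * x * h' (w v * x) - \<alpha> * x * w v * h (w v * x)) / r" for v
    have w': "(w has_real_derivative w v / (r * v)) (at v)" if "v > 0" for v
      unfolding w_def using that
      by (auto intro!: derivative_eq_intros simp: powr_diff)
    have "(q has_integral (1 * k0 x 1 - 0 * k0 x 0)) {0..1}"
    proof (rule fundamental_theorem_of_calculus_interior)
      show "continuous_on {0..1} (\<lambda>v. v * k0 x v)" by (intro continuous_intros sl[OF c0])
      fix v :: real assume v: "v \<in> {0<..<1}"
      then have v0: "v > 0" by simp
      have hx: "((\<lambda>v. h (w v * x)) has_real_derivative (w v / (r * v) * x) * h' (w v * x)) (at v)"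
      proof -
        have "((\<lambda>v. w v * x) has_real_derivative w v / (r * v) * x) (at v)"
          using w'[OF v0] by (auto intro!: derivative_eq_intros)
        from DERIV_chain2[where g = "\<lambda>v. w v * x", OF h this] show ?thesis by (rule DERIV_cong) simp
      qed
      have Ex: "((\<lambda>v. E x v) has_real_derivative E x v * (\<alpha> * x * - (w v / (r * v)))) (at v)"
        unfolding E_def by (auto intro!: derivative_eq_intros w' v0)
      have "((\<lambda>v. v * k0 x v) has_real_derivative q v) (at v)"
        unfolding k0_def
        by (rule DERIV_cong[OF DERIV_mult[OF DERIV_ident DERIV_mult[OF Ex hx]]])
           (use v0 r in \<open>simp add: q_def k0_def field_simps\<close>)
      then show "((\<lambda>v. v * k0 x v) has_vector_derivative q v) (at v)"
        by (simp add: has_real_derivative_iff_has_vector_derivative)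
    qed simp
    moreover have "k0 x 1 = h x" by (simp add: k0_def E_def w_def)
    moreover have "q = (\<lambda>v. (x * k1 x v + (r - \<alpha> * x) * k0 x v) / r)"
      using r by (auto simp: q_def k1_def k0_def field_simps)
    ultimately have "((\<lambda>v. (x * k1 x v + (r - \<alpha> * x) * k0 x v) / r) has_integral h x) {0..1}" by simp
    moreover have "((\<lambda>v. (x * k1 x v + (r - \<alpha> * x) * k0 x v) / r) has_integral
        (x * integral {0..1} (k1 x) + (r - \<alpha> * x) * integral {0..1} (k0 x)) / r) {0..1}"
      by (intro has_integral_divide has_integral_add has_integral_mult_right integrable_integral
          integrable_continuous_interval sl[OF c0] sl[OF c1])
    ultimately show ?thesis
      by (auto simp: f_def f'_def add_divide_distrib dest: has_integral_unique)
  qed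
  show thesis by (rule that[OF f f' f'' eq])
qed

section \<open>A priori boundedness and sharp estimates for the Stein solution\<close>

text \<open>On \<open>[1, \<infinity>)\<close> the equation can be divided by \<open>x\<close>,
  since \<open>k\<close> and \<open>(\<rho> - \<alpha> x) u\<close> grow at most linearly; near
  \<open>0\<close>, where the division fails, continuity of \<open>u'\<close> up to \<open>0\<close>
  takes over. The result is only qualitative and feeds the maximum principles.\<close>

lemma gamma_first_order_derivative_bounded:
  fixes u u' k :: "real \<Rightarrow> real"
  assumes eq: "\<And>x. x > 0 \<Longrightarrow> x * u' x + (\<rho> - \<alpha> * x) * u x = k x"
    and k: "\<And>x. x > 0 \<Longrightarrow> \<bar>k x\<bar> \<le> K + L * x" and K: "K \<ge> 0"
    and bd: "\<And>x. x > 0 \<Longrightarrow> \<bar>u x\<bar> \<le> B"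
    and cont: "continuous_on {0..1} u'"
  obtains B' where "\<And>x. x > 0 \<Longrightarrow> \<bar>u' x\<bar> \<le> B'"
proof -
  have "bounded (u' ` {0..1})" by (intro compact_imp_bounded compact_continuous_image cont) simp
  then obtain A where A: "\<And>x. x \<in> {0..1} \<Longrightarrow> \<bar>u' x\<bar> \<le> A" by (force simp: bounded_iff)
  have B: "B \<ge> 0" using bd[of 1] by simp
  define A' where "A' = K + L + (\<bar>\<rho>\<bar> + \<bar>\<alpha>\<bar>) * B"
  have far: "\<bar>u' x\<bar> \<le> A'" if x: "x \<ge> 1" for x
  proof -
    have "x * \<bar>u' x\<bar> = \<bar>k x - (\<rho> - \<alpha> * x) * u x\<bar>"
      using eq[of x, symmetric] x by (simp add: abs_mult)
    also have "\<dots> \<le> (K + L * x) + \<bar>\<rho> - \<alpha> * x\<bar> * B"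
    proof -
      have "\<bar>(\<rho> - \<alpha> * x) * u x\<bar> \<le> \<bar>\<rho> - \<alpha> * x\<bar> * B"
        unfolding abs_mult using bd[of x] x by (intro mult_left_mono) auto
      then show ?thesis using k[of x] x by linarith
    qed
    also have "\<dots> \<le> (K * x + L * x) + ((\<bar>\<rho>\<bar> + \<bar>\<alpha>\<bar>) * x) * B"
    proof (intro add_mono mult_right_mono B)
      show "K \<le> K * x" using K x by (simp add: mult_le_cancel_left1)
      have "\<bar>\<rho> - \<alpha> * x\<bar> \<le> \<bar>\<rho>\<bar> * 1 + \<bar>\<alpha>\<bar> * x" using x by (auto simp: abs_mult intro: order.trans[OF abs_triangle_ineq4])
      also have "\<dots> \<le> \<bar>\<rho>\<bar> * x + \<bar>\<alpha>\<bar> * x" using x by (intro add_right_mono mult_left_mono) auto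
      finally show "\<bar>\<rho> - \<alpha> * x\<bar> \<le> (\<bar>\<rho>\<bar> + \<bar>\<alpha>\<bar>) * x" by (simp add: algebra_simps)
    qed (use x in auto)
    also have "\<dots> = x * A'" by (simp add: A'_def algebra_simps)
    finally show ?thesis using x by simp
  qed
  show thesis
  proof (rule that[of "max A A'"])
    fix x :: real assume "x > 0"
    then show "\<bar>u' x\<bar> \<le> max A A'" using A[of x] far[of x] by (cases "x \<le> 1") auto
  qed
qed

text \<open>Comparison with a constant \<open>C\<close>: far out the weighted difference
  \<open>D\<close> increases, and its limit is \<open>0\<close>, so it is nonpositive. The
  hypothesis \<open>lim\<close> excludes exponentially growing solutions.\<close>

lemma gamma_stein_upper_at_top:
  fixes f f' ht :: "real \<Rightarrow> real"
  assumes f: "\<And>x. x > 0 \<Longrightarrow> (f has_real_derivative f' x) (at x)"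
    and eq: "\<And>x. x > 0 \<Longrightarrow> x * f' x + (r - \<alpha> * x) * f x = ht x"
    and ht: "\<And>x. x > 0 \<Longrightarrow> - ht x \<le> A + B * x"
    and lim: "((\<lambda>t. t powr r * exp (- \<alpha> * t) * f t) \<longlongrightarrow> 0) at_top"
    and pos: "r > 0" "\<alpha> > 0" "A \<ge> 0" "B \<ge> 0"
  obtains T C where "\<And>t. t \<ge> T \<Longrightarrow> f t \<le> C"
proof -
  \<comment> \<open>The part \<open>B / \<alpha>\<close> of \<open>C\<close> absorbs the linear
    growth \<open>B * z\<close> of the data; the extra \<open>1\<close> leaves a surplus
    \<open>\<alpha> * z\<close>, which exceeds \<open>C * r + A\<close> beyond
    \<open>T\<close>.\<close>
  define C where "C = B / \<alpha> + 1"
  define T where "T = (C * r + A) / \<alpha> + 1"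
  have C: "C > 0" using pos by (auto simp: C_def intro: add_nonneg_pos)
  have T: "T \<ge> 1" using pos C by (auto simp: T_def)
  define D where "D t = t powr r * exp (- \<alpha> * t) * (f t - C)" for t
  have D: "(D has_real_derivative
      t powr (r - 1) * exp (- \<alpha> * t) * (ht t - (r - \<alpha> * t) * C)) (at t)" if "t > 0" for t
  proof -
    have "((\<lambda>t. f t - C) has_real_derivative f' t) (at t)"
      using that by (auto intro!: derivative_eq_intros f)
    moreover have "t * f' t + (r - \<alpha> * t) * (f t - C) = ht t - (r - \<alpha> * t) * C"
      using eq[OF that] by (simp add: right_diff_distrib)
    ultimately show ?thesis
      unfolding D_def using gamma_weight_deriv[of "\<lambda>t. f t - C" "f' t" t r \<alpha>] that by simp
  qed
  have inc: "D s \<le> D t" if "T \<le> s" "s \<le> t" for s t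
  proof (rule DERIV_nonneg_imp_nondecreasing[OF that(2)])
    fix z assume z: "s \<le> z" "z \<le> t"
    have zT: "z \<ge> T" "z > 0" using z that T by auto
    have "C * r + A \<le> \<alpha> * z"
      using zT(1) pos by (simp add: T_def field_simps)
    moreover have "\<alpha> * z * C = B * z + \<alpha> * z" using pos by (simp add: C_def field_simps)
    ultimately have "ht z - (r - \<alpha> * z) * C \<ge> 0" using ht[OF zT(2)] by (simp add: algebra_simps)
    then have "z powr (r - 1) * exp (- \<alpha> * z) * (ht z - (r - \<alpha> * z) * C) \<ge> 0" by auto
    with D[OF zT(2)] show "\<exists>y. (D has_real_derivative y) (at z) \<and> y \<ge> 0" by auto
  qed
  have "((\<lambda>t. t powr r * exp (- \<alpha> * t) * C) \<longlongrightarrow> 0) at_top"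
    using gamma_weight_tendsto_0(2)[of "\<lambda>_. C" C r \<alpha>] pos C by simp
  then have lD: "(D \<longlongrightarrow> 0) at_top"
    unfolding D_def right_diff_distrib using tendsto_diff[OF lim, of _ 0] by simp
  show thesis
  proof (rule that[of T C])
    fix t assume t: "t \<ge> T"
    have "\<forall>\<^sub>F s in at_top. D t \<le> D s"
      using inc t by (auto simp: eventually_at_top_linorder)
    then have "D t \<le> 0" using lD by (intro tendsto_lowerbound[of D 0]) auto
    then show "f t \<le> C" using t T by (simp add: D_def mult_le_0_iff)
  qed
qed

text \<open>By the integrating factor, the weighted solution at \<open>b\<close> is the integral of
  the gamma kernel times \<open>ht\<close> over \<open>{0..b}\<close>; the boundary term at
  \<open>0\<close> vanishes because \<open>r > 0\<close>. The limit is the full integral, which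
  centring makes zero.\<close>

lemma gamma_stein_weight_limit:
  fixes f f' ht :: "real \<Rightarrow> real"
  assumes f: "\<And>x. (f has_real_derivative f' x) (at x)"
    and eq: "\<And>x. x > 0 \<Longrightarrow> x * f' x + (r - \<alpha> * x) * f x = ht x"
    and int: "set_integrable lborel {0..} (\<lambda>t. t powr (r - 1) * exp (- \<alpha> * t) * ht t)"
    and zero: "(LINT t:{0..}|lborel. t powr (r - 1) * exp (- \<alpha> * t) * ht t) = 0"
    and pos: "r > 0"
  shows "((\<lambda>t. t powr r * exp (- \<alpha> * t) * f t) \<longlongrightarrow> 0) at_top"
proof -
  define G where "G t = t powr (r - 1) * exp (- \<alpha> * t) * ht t" for t
  have cf: "continuous_on UNIV f" using f by (meson DERIV_continuous_on has_field_derivative_at_within)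
  have "((\<lambda>b. LINT t:{0..b}|lborel. G t) \<longlongrightarrow> (LINT t:{0..}|lborel. G t)) at_top"
    by (rule tendsto_set_lebesgue_integral_at_top) (use int in \<open>auto simp: G_def[abs_def]\<close>)
  moreover have "(LINT t:{0..b}|lborel. G t) = b powr r * exp (- \<alpha> * b) * f b" if "b \<ge> 0" for b
  proof -
    have "(G has_integral (b powr r * exp (- \<alpha> * b) * f b - 0 powr r * exp (- \<alpha> * 0) * f 0)) {0..b}"
    proof (rule fundamental_theorem_of_calculus_interior[OF that])
      show "continuous_on {0..b} (\<lambda>t. t powr r * exp (- \<alpha> * t) * f t)"
        using pos by (intro continuous_intros continuous_on_powr' continuous_on_subset[OF cf]) auto
      fix t assume t: "t \<in> {0<..<b}"
      show "((\<lambda>t. t powr r * exp (- \<alpha> * t) * f t) has_vector_derivative G t) (at t)"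
        using gamma_weight_deriv[OF f[of t], of r \<alpha>] eq[of t] t
        by (simp add: has_real_derivative_iff_has_vector_derivative[symmetric] G_def)
    qed
    moreover have "set_integrable lborel {0..b} G"
      by (rule set_integrable_subset[of _ "{0..}"]) (use int in \<open>auto simp: G_def[abs_def]\<close>)
    ultimately show ?thesis
      using set_borel_integral_eq_integral(2)[of "{0..b}" G] by (simp add: integral_unique pos)
  qed
  then have "\<forall>\<^sub>F b in at_top. (LINT t:{0..b}|lborel. G t) = b powr r * exp (- \<alpha> * b) * f b"
    unfolding eventually_at_top_linorder by blast
  ultimately have "((\<lambda>b. b powr r * exp (- \<alpha> * b) * f b) \<longlongrightarrow> (LINT t:{0..}|lborel. G t)) at_top"
    by (rule Lim_transform_eventually)
  then show ?thesis using zero by (simp add: G_def)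
qed

text \<open>The hypotheses \<open>int\<close> and \<open>zero\<close> say that \<open>c\<close> is
  the gamma mean of \<open>h\<close>, with the normalising factor cleared.\<close>

lemma gamma_stein_bounds:
  fixes f f' f'' h h' h'' :: "real \<Rightarrow> real"
  assumes h: "\<And>x. (h has_real_derivative h' x) (at x)"
    and h': "\<And>x. (h' has_real_derivative h'' x) (at x)"
    and f: "\<And>x. (f has_real_derivative f' x) (at x)"
    and f': "\<And>x. (f' has_real_derivative f'' x) (at x)"
    and f'': "continuous_on UNIV f''"
    and eq: "\<And>x. x * f' x + (r - \<alpha> * x) * f x = h x - c"
    and B1: "\<And>x. \<bar>h' x\<bar> \<le> B1" and B2: "\<And>x. \<bar>h'' x\<bar> \<le> B2"
    and int: "set_integrable lborel {0..} (\<lambda>t. t powr (r - 1) * exp (- \<alpha> * t) * (h t - c))"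
    and zero: "(LINT t:{0..}|lborel. t powr (r - 1) * exp (- \<alpha> * t) * (h t - c)) = 0"
    and pos: "r > 0" "\<alpha> > 0" and x: "x > 0"
  shows "\<bar>f x\<bar> \<le> B1 / \<alpha>" "\<bar>f' x\<bar> \<le> B2 / (2 * \<alpha>)" "\<bar>f'' x\<bar> \<le> (2 * B2 + 4 * \<alpha> * B1) / (r + 2)"
proof -
  have B1': "B1 \<ge> 0" and B2': "B2 \<ge> 0" using B1[of 0] B2[of 0] by auto
  have cf: "continuous_on UNIV f" using f by (meson DERIV_continuous_on has_field_derivative_at_within)
  have cf': "continuous_on UNIV f'" using f' by (meson DERIV_continuous_on has_field_derivative_at_within)
  define A where "A = \<bar>h 0 - c\<bar>"
  have hlin: "\<bar>h t - c\<bar> \<le> A + B1 * t" if "t > 0" for t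
  proof -
    have "\<exists>z>0. z < t \<and> h t - h 0 = (t - 0) * h' z" by (rule MVT2) (use that h in auto)
    then obtain z where "h t - h 0 = (t - 0) * h' z" by blast
    then have "\<bar>h t - h 0\<bar> \<le> B1 * t" using B1[of z] that by (simp add: abs_mult mult.commute)
    then show ?thesis by (simp add: A_def)
  qed
  have lim: "((\<lambda>t. t powr r * exp (- \<alpha> * t) * f t) \<longlongrightarrow> 0) at_top"
    by (rule gamma_stein_weight_limit[OF f _ int zero pos(1)]) (rule eq)
  obtain T1 C1 where T1: "\<And>t. t \<ge> T1 \<Longrightarrow> f t \<le> C1"
    by (rule gamma_stein_upper_at_top[OF f eq _ lim pos, of A B1])
       (use hlin B1' in \<open>auto simp: A_def abs_le_iff\<close>)
  obtain T2 C2 where T2: "\<And>t. t \<ge> T2 \<Longrightarrow> - f t \<le> C2"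
  proof (rule gamma_stein_upper_at_top[of "\<lambda>t. - f t" "\<lambda>t. - f' t" r \<alpha> "\<lambda>t. - (h t - c)" A B1])
    show "x * - f' x + (r - \<alpha> * x) * - f x = - (h x - c)" for x
      using eq[of x] by (simp add: algebra_simps)
    show "((\<lambda>t. t powr r * exp (- \<alpha> * t) * - f t) \<longlongrightarrow> 0) at_top"
      using tendsto_minus[OF lim] by simp
    show "- (- (h x - c)) \<le> A + B1 * x" if "x > 0" for x using hlin[OF that] by simp
  qed (use B1' pos in \<open>auto intro!: derivative_eq_intros f simp: A_def\<close>)
  define T where "T = max T1 T2"
  have "bounded (f ` {0..T})" by (intro compact_imp_bounded compact_continuous_image continuous_on_subset[OF cf]) auto
  then obtain C0 where C0: "\<And>x. x \<in> {0..T} \<Longrightarrow> \<bar>f x\<bar> \<le> C0" by (force simp: bounded_iff)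
  define B where "B = max C0 (max \<bar>C1\<bar> \<bar>C2\<bar>)"
  have bf: "\<bar>f t\<bar> \<le> B" if "t > 0" for t
  proof (cases "t \<le> T")
    case False
    then have "f t \<le> C1" "- f t \<le> C2" using T1 T2 by (auto simp: T_def)
    then show ?thesis unfolding B_def by linarith
  qed (use C0[of t] that in \<open>auto simp: B_def\<close>)
  have eq1: "x * f'' x + (r + 1 - \<alpha> * x) * f' x - \<alpha> * f x = h' x" for x
  proof -
    have "((\<lambda>x. x * f' x + (r - \<alpha> * x) * f x) has_real_derivative
        x * f'' x + (r + 1 - \<alpha> * x) * f' x - \<alpha> * f x) (at x)"
      by (auto intro!: derivative_eq_intros f f' simp: algebra_simps)
    moreover have "((\<lambda>x. h x - c) has_real_derivative h' x) (at x)"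
      by (auto intro!: derivative_eq_intros h)
    ultimately show ?thesis unfolding eq by (rule DERIV_unique)
  qed
  \<comment> \<open>Away from \<open>0\<close> the once differentiated equation expresses
    \<open>f''\<close> as a quotient of differentiable functions, so a third derivative exists there
    although \<open>h\<close> has only two; \<open>f3\<close> is the value that the twice
    differentiated equation prescribes.\<close>
  define f3 where "f3 x = (h'' x + 2 * \<alpha> * f' x - (r + 2 - \<alpha> * x) * f'' x) / x" for x
  have f3: "(f'' has_real_derivative f3 x) (at x)" if "x > 0" for x
  proof -
    have e: "(h' x + \<alpha> * f x - (r + 1 - \<alpha> * x) * f' x) / x = f'' x" if "x > 0" for x
      using eq1[of x] that by (simp add: field_simps)
    have "((\<lambda>x. (h' x + \<alpha> * f x - (r + 1 - \<alpha> * x) * f' x) / x) has_real_derivative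
       ((h'' x + \<alpha> * f' x - (- \<alpha> * f' x + (r + 1 - \<alpha> * x) * f'' x)) * x
        - (h' x + \<alpha> * f x - (r + 1 - \<alpha> * x) * f' x) * 1) / (x * x)) (at x)"
      using that by (auto intro!: derivative_eq_intros f f' h')
    also have "h' x + \<alpha> * f x - (r + 1 - \<alpha> * x) * f' x = x * f'' x"
      using eq1[of x] by simp
    also have "((h'' x + \<alpha> * f' x - (- \<alpha> * f' x + (r + 1 - \<alpha> * x) * f'' x)) * x - x * f'' x * 1) / (x * x) = f3 x"
      using that by (simp add: f3_def field_simps)
    finally show ?thesis
      by (rule has_field_derivative_transform_within_open[of _ _ _ "{0<..}"]) (use that e in auto)
  qed
  have eq2: "x * f3 x + (r + 2 - \<alpha> * x) * f'' x - 2 * \<alpha> * f' x = h'' x" if "x > 0" for x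
    using that by (simp add: f3_def)
  obtain C' where bf': "\<And>x. x > 0 \<Longrightarrow> \<bar>f' x\<bar> \<le> C'"
    by (rule gamma_first_order_derivative_bounded[OF eq hlin _ bf continuous_on_subset[OF cf']])
       (auto simp: A_def)
  have eq1': "x * f'' x + (r + 1 - \<alpha> * x) * f' x = h' x + \<alpha> * f x" for x
    using eq1[of x] by simp
  have eq2': "x * f3 x + (r + 2 - \<alpha> * x) * f'' x = h'' x + 2 * \<alpha> * f' x" if "x > 0" for x
    using eq2[OF that] by simp
  \<comment> \<open>The zeroth-order coefficient is \<open>\<alpha>\<close> after one
    differentiation and \<open>2 * \<alpha>\<close> after two; these are the denominators in the
    bounds for \<open>f\<close> and \<open>f'\<close>.\<close>
  have fb: "\<bar>f x\<bar> \<le> B1 / \<alpha>" if "x > 0" for x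
    by (rule laguerre_maximum_principle_abs[OF f f' eq1 B1 bf _ pos(2,2) that]) (use pos in auto)
  have f'b: "\<bar>f' x\<bar> \<le> B2 / (2 * \<alpha>)" if "x > 0" for x
    by (rule laguerre_maximum_principle_abs[OF f' f3 eq2 B2 bf' _ pos(2) _ that]) (use pos in auto)
  have k1: "\<bar>h' x + \<alpha> * f x\<bar> \<le> 2 * B1" if "x > 0" for x
  proof -
    have "\<bar>\<alpha> * f x\<bar> \<le> B1" using fb[OF that] pos by (simp add: abs_mult field_simps)
    with B1[of x] show ?thesis by linarith
  qed
  have k2: "\<bar>h'' x + 2 * \<alpha> * f' x\<bar> \<le> 2 * B2" if "x > 0" for x
  proof -
    have "\<bar>2 * \<alpha> * f' x\<bar> \<le> B2" using f'b[OF that] pos by (simp add: abs_mult field_simps)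
    with B2[of x] show ?thesis by linarith
  qed
  obtain C'' where bf'': "\<And>x. x > 0 \<Longrightarrow> \<bar>f'' x\<bar> \<le> C''"
    by (rule gamma_first_order_derivative_bounded[OF eq1' _ _ bf' continuous_on_subset[OF f''], where K = "2 * B1" and L = 0])
       (use k1 B1' in auto)
  \<comment> \<open>In \<open>x f'' = (h' + \<alpha> f) - (r + 1 - \<alpha> x) f'\<close> both terms
    are at most \<open>2 * B1\<close>, which bounds \<open>x f''\<close> by
    \<open>4 * B1\<close>.\<close>
  have "\<bar>(r + 1 - \<alpha> * x) * f' x\<bar> \<le> 2 * B1"
    by (rule gamma_first_order_bound[OF f' eq1' k1 bf' _ pos(2) x]) (use pos in auto)
  then have "\<bar>x * f'' x\<bar> \<le> 4 * B1" using eq1'[of x] k1[OF x] by linarith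
  then have xf'': "x * \<bar>f'' x\<bar> \<le> 4 * B1" using x by (simp add: abs_mult)
  have "\<bar>(r + 2 - \<alpha> * x) * f'' x\<bar> \<le> 2 * B2"
    by (rule gamma_first_order_bound[OF f3 eq2' k2 bf'' _ pos(2) x]) (use pos in auto)
  \<comment> \<open>Adding \<open>\<alpha> (x f'')\<close> cancels the variable part of
    \<open>r + 2 - \<alpha> x\<close>: the zero of this factor does no harm, and
    \<open>r + 2\<close> appears in the final denominator.\<close>
  moreover have "(r + 2) * \<bar>f'' x\<bar> = \<bar>(r + 2 - \<alpha> * x) * f'' x + \<alpha> * (x * f'' x)\<bar>"
  proof -
    have "(r + 2 - \<alpha> * x) * f'' x + \<alpha> * (x * f'' x) = (r + 2) * f'' x" by (simp add: algebra_simps)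
    then show ?thesis using pos by (simp add: abs_mult)
  qed
  moreover have "\<bar>\<alpha> * (x * f'' x)\<bar> \<le> 4 * \<alpha> * B1"
    using mult_left_mono[OF xf'', of \<alpha>] pos x by (simp add: abs_mult)
  ultimately have "(r + 2) * \<bar>f'' x\<bar> \<le> 2 * B2 + 4 * \<alpha> * B1" by linarith
  then show "\<bar>f'' x\<bar> \<le> (2 * B2 + 4 * \<alpha> * B1) / (r + 2)" using pos by (simp add: field_simps)
  show "\<bar>f x\<bar> \<le> B1 / \<alpha>" "\<bar>f' x\<bar> \<le> B2 / (2 * \<alpha>)" using fb f'b x by auto
qed

section \<open>Smoothing\<close>

lemma lipschitz_continuous:
  fixes h :: "real \<Rightarrow> real"
  assumes "\<And>x y. \<bar>h x - h y\<bar> \<le> L * \<bar>x - y\<bar>"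
  shows "continuous_on UNIV h"
proof -
  have "\<bar>L\<bar>-lipschitz_on UNIV h"
  proof (rule lipschitz_onI)
    fix x y :: real
    show "dist (h x) (h y) \<le> \<bar>L\<bar> * dist x y"
      unfolding dist_real_def by (rule order.trans[OF assms]) (simp add: mult_right_mono)
  qed simp
  then show ?thesis by (rule lipschitz_on_continuous_on)
qed

text \<open>\<open>g\<close> is the mean of \<open>h\<close> over \<open>[x - d, x + d]\<close>. By
  the mean value theorem for an antiderivative it takes a value of \<open>h\<close> within distance
  \<open>d\<close>; this form gives the approximation error and also preserves ranges and locally
  constant values.\<close>

lemma moving_average:
  fixes h :: "real \<Rightarrow> real"
  assumes "continuous_on UNIV h" and d: "d > 0"
  obtains g where "\<And>x. (g has_real_derivative (h (x + d) - h (x - d)) / (2 * d)) (at x)"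
    "\<And>x. \<exists>\<xi>. \<bar>\<xi> - x\<bar> < d \<and> g x = h \<xi>"
proof -
  have "\<exists>H. \<forall>x::real. - \<infinity> < ereal x \<longrightarrow> ereal x < \<infinity> \<longrightarrow> (H has_vector_derivative h x) (at x)"
    by (rule einterval_antiderivative) (use assms(1) in \<open>auto simp: continuous_on_eq_continuous_at\<close>)
  then obtain H where H: "\<And>x. (H has_real_derivative h x) (at x)"
    by (auto simp: has_real_derivative_iff_has_vector_derivative)
  define g where "g x = (H (x + d) - H (x - d)) / (2 * d)" for x
  show thesis
  proof (rule that[of g])
    fix x
    have "((\<lambda>x. H (x + d)) has_real_derivative h (x + d)) (at x)"
      "((\<lambda>x. H (x + - d)) has_real_derivative h (x + - d)) (at x)"
      using H[of "x + d"] H[of "x + - d"] by (simp_all only: DERIV_shift)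
    then show "(g has_real_derivative (h (x + d) - h (x - d)) / (2 * d)) (at x)"
      unfolding g_def by (intro DERIV_cdivide DERIV_diff) auto
    have "\<exists>z>x - d. z < x + d \<and> H (x + d) - H (x - d) = ((x + d) - (x - d)) * h z"
      by (rule MVT2) (use d H in auto)
    then obtain z where z: "x - d < z" "z < x + d" "H (x + d) - H (x - d) = ((x + d) - (x - d)) * h z"
      by blast
    then show "\<exists>\<xi>. \<bar>\<xi> - x\<bar> < d \<and> g x = h \<xi>"
      using d by (intro exI[of _ z]) (auto simp: g_def abs_less_iff)
  qed
qed

text \<open>The first average, of width \<open>d\<close>, already has a derivative with Lipschitz
  constant \<open>L / d\<close>. The second only makes the second derivative continuous and does not
  worsen the bound, so \<open>e\<close> enters through the displacement alone.\<close>

lemma smooth_lipschitz: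
  fixes h :: "real \<Rightarrow> real"
  assumes h: "\<And>x y. \<bar>h x - h y\<bar> \<le> L * \<bar>x - y\<bar>" and d: "d > 0" "e > 0"
  obtains g g' g'' where
    "\<And>x. (g has_real_derivative g' x) (at x)"
    "\<And>x. (g' has_real_derivative g'' x) (at x)"
    "continuous_on UNIV g''"
    "\<And>x. \<bar>g' x\<bar> \<le> L" "\<And>x. \<bar>g'' x\<bar> \<le> L / d"
    "\<And>x. \<exists>\<xi>. \<bar>\<xi> - x\<bar> < d + e \<and> g x = h \<xi>"
proof -
  define k' where "k' x = (h (x + d) - h (x - d)) / (2 * d)" for x
  have ch: "continuous_on UNIV h" by (rule lipschitz_continuous[OF h])
  obtain k where k: "\<And>x. (k has_real_derivative k' x) (at x)"
    "\<And>x. \<exists>\<xi>. \<bar>\<xi> - x\<bar> < d \<and> k x = h \<xi>"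
    by (rule moving_average[OF ch d(1)]) (auto simp: k'_def)
  have ck': "continuous_on UNIV k'" unfolding k'_def using d
    by (intro continuous_intros continuous_on_compose2[OF ch]) auto
  have bk': "\<bar>k' x\<bar> \<le> L" for x
    using h[of "x + d" "x - d"] d by (simp add: k'_def field_simps abs_if split: if_splits)
  have lk': "\<bar>k' x - k' y\<bar> \<le> (L / d) * \<bar>x - y\<bar>" for x y
  proof -
    have "\<bar>(h (x + d) - h (y + d)) - (h (x - d) - h (y - d))\<bar> \<le> L * \<bar>x - y\<bar> + L * \<bar>x - y\<bar>"
      using h[of "x + d" "y + d"] h[of "x - d" "y - d"] by simp
    moreover have "k' x - k' y = ((h (x + d) - h (y + d)) - (h (x - d) - h (y - d))) / (2 * d)"
      by (simp add: k'_def diff_divide_distrib)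
    ultimately have "2 * d * \<bar>k' x - k' y\<bar> \<le> 2 * (L * \<bar>x - y\<bar>)" using d by (simp add: abs_divide)
    then show ?thesis using d by (simp add: pos_le_divide_eq mult.commute)
  qed
  have lk: "\<bar>k x - k y\<bar> \<le> L * \<bar>x - y\<bar>" for x y
    using field_differentiable_bound[of UNIV k k' L x y, OF convex_UNIV] k(1) bk'
    by (simp add: has_field_derivative_at_within)
  have ck: "continuous_on UNIV k" by (rule lipschitz_continuous[OF lk])
  define g' where "g' x = (k (x + e) - k (x - e)) / (2 * e)" for x
  define g'' where "g'' x = (k' (x + e) - k' (x - e)) / (2 * e)" for x
  obtain g where g: "\<And>x. (g has_real_derivative g' x) (at x)"
    "\<And>x. \<exists>\<xi>. \<bar>\<xi> - x\<bar> < e \<and> g x = k \<xi>"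
    by (rule moving_average[OF ck d(2)]) (auto simp: g'_def)
  show thesis
  proof (rule that[of g g' g''])
    fix x
    show "(g has_real_derivative g' x) (at x)" by (rule g)
    have "((\<lambda>x. k (x + e)) has_real_derivative k' (x + e)) (at x)"
      "((\<lambda>x. k (x + - e)) has_real_derivative k' (x + - e)) (at x)"
      using k(1)[of "x + e"] k(1)[of "x + - e"] by (simp_all only: DERIV_shift)
    then show "(g' has_real_derivative g'' x) (at x)"
      unfolding g'_def g''_def by (intro DERIV_cdivide DERIV_diff) auto
    show "continuous_on UNIV g''" unfolding g''_def using d
      by (intro continuous_intros continuous_on_compose2[OF ck']) auto
    show "\<bar>g' x\<bar> \<le> L"
      using lk[of "x + e" "x - e"] d by (simp add: g'_def field_simps abs_if split: if_splits)
    show "\<bar>g'' x\<bar> \<le> L / d"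
    proof -
      have "\<bar>k' (x + e) - k' (x - e)\<bar> \<le> (L / d) * (2 * e)"
        using lk'[of "x + e" "x - e"] d by simp
      then show ?thesis using d by (simp add: g''_def pos_divide_le_eq abs_divide)
    qed
    obtain \<xi> where \<xi>: "\<bar>\<xi> - x\<bar> < e" "g x = k \<xi>" using g(2) by blast
    obtain \<zeta> where \<zeta>: "\<bar>\<zeta> - \<xi>\<bar> < d" "k \<xi> = h \<zeta>" using k(2) by blast
    show "\<exists>\<xi>. \<bar>\<xi> - x\<bar> < d + e \<and> g x = h \<xi>"
      using \<xi> \<zeta> by (intro exI[of _ \<zeta>]) auto
  qed
qed

section \<open>Gamma distributions\<close>

lemma nn_integral_gamma_kernel:
  assumes r: "r > 0" "\<alpha> > 0"
  shows "(\<integral>\<^sup>+t. ennreal (indicator {0..} t * (t powr (r - 1) * exp (- \<alpha> * t))) \<partial>lborel)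
    = ennreal (Gamma r / \<alpha> powr r)"
proof -
  define g where "g t = (if 0 \<le> t then t powr (r - 1) / exp t else 0)" for t :: real
  have "((\<lambda>t. if t \<in> {0..} then t powr (r - 1) / exp t else 0) has_integral Gamma r) UNIV"
    using Gamma_integral_real[OF r(1)] unfolding has_integral_restrict_UNIV .
  then have "(g has_integral Gamma r) UNIV" by (simp add: g_def[abs_def])
  then have "(\<integral>\<^sup>+t. ennreal (g t) \<partial>lborel) = ennreal (Gamma r)"
    by (rule nn_integral_has_integral_lborel[rotated 2]) (auto simp: g_def[abs_def])
  also have "(\<integral>\<^sup>+t. ennreal (g t) \<partial>lborel) = ennreal \<bar>\<alpha>\<bar> * (\<integral>\<^sup>+t. ennreal (g (0 + \<alpha> * t)) \<partial>lborel)"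
    by (rule nn_integral_real_affine) (use r in \<open>auto simp: g_def\<close>)
  also have "(\<integral>\<^sup>+t. ennreal (g (0 + \<alpha> * t)) \<partial>lborel) =
     (\<integral>\<^sup>+t. ennreal (\<alpha> powr (r - 1)) * ennreal (indicator {0..} t * (t powr (r - 1) * exp (- \<alpha> * t))) \<partial>lborel)"
  proof (rule nn_integral_cong)
    fix t
    have "g (\<alpha> * t) = \<alpha> powr (r - 1) * (indicator {0..} t * (t powr (r - 1) * exp (- \<alpha> * t)))"
      using r by (cases "t \<ge> 0") (simp_all add: g_def powr_mult exp_minus divide_inverse zero_le_mult_iff)
    then show "ennreal (g (0 + \<alpha> * t)) = ennreal (\<alpha> powr (r - 1)) * ennreal (indicator {0..} t * (t powr (r - 1) * exp (- \<alpha> * t)))"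
      by (simp add: ennreal_mult[symmetric])
  qed
  also have "\<dots> = ennreal (\<alpha> powr (r - 1)) * (\<integral>\<^sup>+t. ennreal (indicator {0..} t * (t powr (r - 1) * exp (- \<alpha> * t))) \<partial>lborel)"
    by (rule nn_integral_cmult) auto
  finally have e: "ennreal (\<alpha> powr r) * (\<integral>\<^sup>+t. ennreal (indicator {0..} t * (t powr (r - 1) * exp (- \<alpha> * t))) \<partial>lborel) = ennreal (Gamma r)"
    using r by (simp add: mult.assoc[symmetric] ennreal_mult[symmetric] powr_diff)
  define I where "I = (\<integral>\<^sup>+t. ennreal (indicator {0..} t * (t powr (r - 1) * exp (- \<alpha> * t))) \<partial>lborel)"
  have a: "\<alpha> powr r > 0" using r by simp
  have "I \<noteq> \<infinity>" using e a unfolding I_def[symmetric]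
    by (auto simp: ennreal_mult_eq_top_iff)
  then obtain x where x: "I = ennreal x" "x \<ge> 0" by (cases I) auto
  have "ennreal (\<alpha> powr r * x) = ennreal (Gamma r)"
    using e x a unfolding I_def[symmetric] by (simp add: ennreal_mult)
  then have "\<alpha> powr r * x = Gamma r"
    using x a r by (subst (asm) ennreal_inj) (auto intro: Gamma_real_nonneg less_imp_le)
  then have "x = Gamma r / \<alpha> powr r" using a by (auto simp: field_simps)
  then show ?thesis unfolding I_def[symmetric] using x(1) by simp
qed

lemma gamma_kernel_integral:
  fixes r \<alpha> :: real
  assumes r: "r > 0" "\<alpha> > 0"
  shows "integrable lborel (\<lambda>t. indicator {0..} t * (t powr (r - 1) * exp (- \<alpha> * t)))"
    and "(LINT t|lborel. indicator {0..} t * (t powr (r - 1) * exp (- \<alpha> * t))) = Gamma r / \<alpha> powr r"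
proof -
  have G: "Gamma r > 0" using r by (simp add: Gamma_real_pos)
  have p: "\<alpha> powr r > 0" using r by simp
  show 1: "integrable lborel (\<lambda>t. indicator {0..} t * (t powr (r - 1) * exp (- \<alpha> * t)))"
    by (rule integrableI_nn_integral_finite[OF _ _ nn_integral_gamma_kernel[OF r]]) auto
  show "(LINT t|lborel. indicator {0..} t * (t powr (r - 1) * exp (- \<alpha> * t))) = Gamma r / \<alpha> powr r"
    by (rule integral_eq_nn_integral[THEN trans])
       (use nn_integral_gamma_kernel[OF r] G p in \<open>auto simp: enn2real_ennreal less_imp_le\<close>)
qed

text \<open>The two densities agree even at \<open>t = 0\<close>, because
  \<open>0 powr (r - 1)\<close> is \<open>0\<close> for every \<open>r\<close>.\<close>

lemma gamma_dist_eq: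
  assumes "r > 0" "\<alpha> > 0"
  shows "gamma_dist r \<alpha> = density lborel
    (\<lambda>t. ennreal ((\<alpha> powr r / Gamma r) * (indicator {0..} t * (t powr (r - 1) * exp (- \<alpha> * t)))))"
  unfolding gamma_dist_def
  by (rule arg_cong[where f = "density lborel"])
     (auto simp: fun_eq_iff mult.assoc split: split_indicator)

lemma real_distribution_gamma_dist:
  assumes r: "r > 0" "\<alpha> > 0"
  shows "real_distribution (gamma_dist r \<alpha>)"
proof -
  have G: "Gamma r > 0" using r by (simp add: Gamma_real_pos)
  have p: "\<alpha> powr r > 0" using r by simp
  interpret prob_space "gamma_dist r \<alpha>"
  proof
    have "emeasure (gamma_dist r \<alpha>) (space (gamma_dist r \<alpha>)) =
      (\<integral>\<^sup>+t. ennreal (\<alpha> powr r / Gamma r) * ennreal (indicator {0..} t * (t powr (r - 1) * exp (- \<alpha> * t))) \<partial>lborel)"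
      unfolding gamma_dist_eq[OF r] using G p
      by (simp add: emeasure_density ennreal_mult[symmetric] less_imp_le)
    also have "\<dots> = ennreal (\<alpha> powr r / Gamma r) * ennreal (Gamma r / \<alpha> powr r)"
      by (subst nn_integral_cmult, simp, subst nn_integral_gamma_kernel[OF r], rule refl)
    also have "\<dots> = 1" using G p by (simp add: ennreal_mult[symmetric] less_imp_le)
    finally show "emeasure (gamma_dist r \<alpha>) (space (gamma_dist r \<alpha>)) = 1" .
  qed
  show ?thesis by unfold_locales (auto simp: gamma_dist_def)
qed

lemma integrable_gamma_dist_iff:
  assumes r: "r > 0" "\<alpha> > 0" and h: "h \<in> borel_measurable borel"
  shows "integrable (gamma_dist r \<alpha>) h \<longleftrightarrow>
    set_integrable lborel {0..} (\<lambda>t. t powr (r - 1) * exp (- \<alpha> * t) * h t)"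
proof -
  have G: "Gamma r > 0" using r by (simp add: Gamma_real_pos)
  have p: "\<alpha> powr r > 0" using r by simp
  have "integrable (gamma_dist r \<alpha>) h \<longleftrightarrow> integrable lborel (\<lambda>t. (\<alpha> powr r / Gamma r) * (indicator {0..} t * (t powr (r - 1) * exp (- \<alpha> * t))) * h t)"
    unfolding gamma_dist_eq[OF r] using G p h
    by (subst integrable_real_density) auto
  also have "\<dots> \<longleftrightarrow> integrable lborel (\<lambda>t. (\<alpha> powr r / Gamma r) * (indicator {0..} t *\<^sub>R (t powr (r - 1) * exp (- \<alpha> * t) * h t)))"
    by (simp add: mult.assoc)
  also have "\<dots> \<longleftrightarrow> set_integrable lborel {0..} (\<lambda>t. t powr (r - 1) * exp (- \<alpha> * t) * h t)"
    unfolding set_integrable_def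
    by (rule integrable_mult_left_iff[THEN trans]) (use G p in simp)
  finally show ?thesis .
qed

lemma integral_gamma_dist:
  assumes r: "r > 0" "\<alpha> > 0" and h: "h \<in> borel_measurable borel"
  shows "(\<integral>t. h t \<partial>gamma_dist r \<alpha>) =
    (\<alpha> powr r / Gamma r) * (LINT t:{0..}|lborel. t powr (r - 1) * exp (- \<alpha> * t) * h t)"
proof -
  have G: "Gamma r > 0" using r by (simp add: Gamma_real_pos)
  have p: "\<alpha> powr r > 0" using r by simp
  have "(\<integral>t. h t \<partial>gamma_dist r \<alpha>) = (LINT t|lborel. (\<alpha> powr r / Gamma r) * (indicator {0..} t * (t powr (r - 1) * exp (- \<alpha> * t))) * h t)"
    unfolding gamma_dist_eq[OF r] using G p h
    by (subst integral_real_density) auto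
  also have "\<dots> = (LINT t|lborel. (\<alpha> powr r / Gamma r) * (indicator {0..} t *\<^sub>R (t powr (r - 1) * exp (- \<alpha> * t) * h t)))"
    by (simp add: mult.assoc)
  also have "\<dots> = (\<alpha> powr r / Gamma r) * (LINT t:{0..}|lborel. t powr (r - 1) * exp (- \<alpha> * t) * h t)"
    unfolding set_lebesgue_integral_def by (rule integral_mult_right_zero)
  finally show ?thesis .
qed

lemma integrable_gamma_dist_id:
  assumes r: "r > 0" "\<alpha> > 0"
  shows "integrable (gamma_dist r \<alpha>) (\<lambda>x. x)"
proof -
  have "integrable lborel (\<lambda>t. indicator {0..} t * (t powr ((r + 1) - 1) * exp (- \<alpha> * t)))"
    by (rule gamma_kernel_integral) (use r in auto)
  also have "(\<lambda>t. indicator {0..} t * (t powr ((r + 1) - 1) * exp (- \<alpha> * t))) =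
     (\<lambda>t. indicator {0..} t *\<^sub>R (t powr (r - 1) * exp (- \<alpha> * t) * t))"
    using r by (auto simp: fun_eq_iff powr_diff split: split_indicator)
  finally show ?thesis by (simp add: integrable_gamma_dist_iff[OF r] set_integrable_def)
qed

lemma (in real_distribution) integrable_lipschitz:
  fixes h :: "real \<Rightarrow> real"
  assumes id: "integrable M (\<lambda>x. x)" and h: "\<And>x y. \<bar>h x - h y\<bar> \<le> L * \<bar>x - y\<bar>"
  shows "integrable M h"
proof (rule Bochner_Integration.integrable_bound)
  show "integrable M (\<lambda>x. \<bar>h 0\<bar> + L * \<bar>x\<bar>)" using id by auto
  show "h \<in> borel_measurable M"
    using borel_measurable_continuous_onI[OF lipschitz_continuous[OF h]] by simp
  show "AE x in M. norm (h x) \<le> norm (\<bar>h 0\<bar> + L * \<bar>x\<bar>)"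
  proof (rule AE_I2)
    fix x show "norm (h x) \<le> norm (\<bar>h 0\<bar> + L * \<bar>x\<bar>)" using h[of x 0] by auto
  qed
qed

section \<open>Compound Poisson laws\<close>

locale nonneg_law = real_distribution P for P :: "real measure" +
  assumes nonneg: "AE x in P. 0 \<le> x"
begin

sublocale seq: sequence_space P ..

text \<open>Extended nonnegative expectations make the size-bias identities free of integrability
  conditions; the moments of the compound law are later derived from them.\<close>

definition partial_sum_nn :: "nat \<Rightarrow> (real \<Rightarrow> ennreal) \<Rightarrow> ennreal" where
  "partial_sum_nn n g = (\<integral>\<^sup>+\<omega>. g (\<Sum>i<n. \<omega> i) \<partial>PiM UNIV (\<lambda>_::nat. P))"

lemma measurable_partial_sum[measurable]:
  "(\<lambda>\<omega>. \<Sum>i<n. \<omega> i) \<in> borel_measurable (PiM UNIV (\<lambda>_::nat. P))"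
  by measurable

lemma measurable_partial_sum_nn:
  assumes [measurable]: "(\<lambda>(x, s). g x s) \<in> borel_measurable (N \<Otimes>\<^sub>M borel)"
  shows "(\<lambda>x. partial_sum_nn n (g x)) \<in> borel_measurable N"
  unfolding partial_sum_nn_def by measurable

lemma partial_sum_nn_0: "partial_sum_nn 0 g = g 0"
  by (simp add: partial_sum_nn_def seq.P.emeasure_space_1)

text \<open>Prepending an independent coordinate to an i.i.d. sequence reproduces its law, so the
  first summand can be integrated separately.\<close>

lemma partial_sum_nn_Suc:
  assumes [measurable]: "g \<in> borel_measurable borel"
  shows "partial_sum_nn (Suc n) g = (\<integral>\<^sup>+x. partial_sum_nn n (\<lambda>s. g (x + s)) \<partial>P)"
proof -
  let ?S = "PiM UNIV (\<lambda>_::nat. P)"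
  have "partial_sum_nn (Suc n) g =
    (\<integral>\<^sup>+\<omega>. g (\<Sum>i<Suc n. \<omega> i) \<partial>distr (P \<Otimes>\<^sub>M ?S) ?S (\<lambda>(x, \<omega>). case_nat x \<omega>))"
    unfolding partial_sum_nn_def seq.PiM_iter ..
  also have "\<dots> = (\<integral>\<^sup>+z. g (\<Sum>i<Suc n. (case z of (x, \<omega>) \<Rightarrow> case_nat x \<omega>) i) \<partial>(P \<Otimes>\<^sub>M ?S))"
    by (rule nn_integral_distr) measurable
  also have "\<dots> = (\<integral>\<^sup>+z. g (fst z + (\<Sum>i<n. snd z i)) \<partial>(P \<Otimes>\<^sub>M ?S))"
    by (intro nn_integral_cong) (auto simp: sum.lessThan_Suc_shift simp del: sum.lessThan_Suc)
  also have "\<dots> = (\<integral>\<^sup>+x. \<integral>\<^sup>+\<omega>. g (x + (\<Sum>i<n. \<omega> i)) \<partial>?S \<partial>P)"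
    by (subst seq.P.nn_integral_fst[symmetric]) auto
  finally show ?thesis by (simp add: partial_sum_nn_def)
qed

lemma AE_partial_sum_nonneg: "AE \<omega> in PiM UNIV (\<lambda>_::nat. P). 0 \<le> (\<Sum>i<n. \<omega> i)"
proof -
  have "AE \<omega> in PiM UNIV (\<lambda>_::nat. P). \<forall>i. 0 \<le> \<omega> i"
    unfolding AE_all_countable
    using AE_PiM_component[of UNIV "\<lambda>_::nat. P" _ "\<lambda>x. 0 \<le> x"] nonneg prob_space_axioms by auto
  then show ?thesis by eventually_elim (auto intro: sum_nonneg)
qed

text \<open>The summands are exchangeable, so each contributes the same amount to
  \<open>\<E>[S\<^sub>n\<^sub>+\<^sub>1 g (S\<^sub>n\<^sub>+\<^sub>1)]\<close>.\<close>

lemma partial_sum_nn_size_bias: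
  assumes "g \<in> borel_measurable borel"
  shows "partial_sum_nn (Suc n) (\<lambda>s. ennreal s * g s)
    = of_nat (Suc n) * (\<integral>\<^sup>+x. ennreal x * partial_sum_nn n (\<lambda>s. g (x + s)) \<partial>P)"
  using assms
proof (induction n arbitrary: g)
  case (0 g)
  note [measurable] = 0
  show ?case by (subst partial_sum_nn_Suc) (simp_all add: partial_sum_nn_0)
next
  case (Suc n g)
  note [measurable] = Suc.prems measurable_partial_sum_nn
  let ?A = "\<integral>\<^sup>+x. ennreal x * partial_sum_nn (Suc n) (\<lambda>s. g (x + s)) \<partial>P"
  \<comment> \<open>\<open>ennreal\<close> sends negative reals to \<open>0\<close>, so it is
    additive here only because both \<open>x\<close> and the partial sum are almost surely
    nonnegative.\<close>
  have split: "partial_sum_nn (Suc n) (\<lambda>s. ennreal (x + s) * g (x + s)) =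
      ennreal x * partial_sum_nn (Suc n) (\<lambda>s. g (x + s))
      + partial_sum_nn (Suc n) (\<lambda>s. ennreal s * g (x + s))" if "0 \<le> x" for x
  proof -
    have "partial_sum_nn (Suc n) (\<lambda>s. ennreal (x + s) * g (x + s)) =
       (\<integral>\<^sup>+\<omega>. ennreal x * g (x + (\<Sum>i<Suc n. \<omega> i)) + ennreal (\<Sum>i<Suc n. \<omega> i) * g (x + (\<Sum>i<Suc n. \<omega> i))
          \<partial>PiM UNIV (\<lambda>_::nat. P))"
      unfolding partial_sum_nn_def
      by (rule nn_integral_cong_AE, rule AE_mp[OF AE_partial_sum_nonneg[of "Suc n"]], rule AE_I2)
         (use that in \<open>auto simp: distrib_right simp del: sum.lessThan_Suc\<close>)
    then show ?thesis
      unfolding partial_sum_nn_def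
      by (subst (asm) nn_integral_add) (auto simp: nn_integral_cmult simp del: sum.lessThan_Suc)
  qed
  have "partial_sum_nn (Suc (Suc n)) (\<lambda>s. ennreal s * g s) =
      (\<integral>\<^sup>+x. partial_sum_nn (Suc n) (\<lambda>s. ennreal (x + s) * g (x + s)) \<partial>P)"
    by (subst partial_sum_nn_Suc) simp_all
  also have "\<dots> = (\<integral>\<^sup>+x. ennreal x * partial_sum_nn (Suc n) (\<lambda>s. g (x + s))
      + partial_sum_nn (Suc n) (\<lambda>s. ennreal s * g (x + s)) \<partial>P)"
    by (rule nn_integral_cong_AE) (use nonneg split in auto)
  also have "\<dots> = ?A + (\<integral>\<^sup>+x. partial_sum_nn (Suc n) (\<lambda>s. ennreal s * g (x + s)) \<partial>P)"
    by (rule nn_integral_add) measurable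
  also have "(\<integral>\<^sup>+x. partial_sum_nn (Suc n) (\<lambda>s. ennreal s * g (x + s)) \<partial>P) =
      (\<integral>\<^sup>+x. of_nat (Suc n) * (\<integral>\<^sup>+y. ennreal y * partial_sum_nn n (\<lambda>s. g (x + (y + s))) \<partial>P) \<partial>P)"
    by (intro nn_integral_cong Suc.IH) measurable
  also have "\<dots> = of_nat (Suc n) * (\<integral>\<^sup>+x. (\<integral>\<^sup>+y. ennreal y * partial_sum_nn n (\<lambda>s. g (x + (y + s))) \<partial>P) \<partial>P)"
    by (rule nn_integral_cmult) measurable
  \<comment> \<open>Exchangeability enters as Fubini: with \<open>y\<close> outside, the summand
    \<open>x\<close> joins the partial sum, and the weight is again on the summand split off, as in
    \<open>?A\<close>.\<close>
  also have "(\<integral>\<^sup>+x. (\<integral>\<^sup>+y. ennreal y * partial_sum_nn n (\<lambda>s. g (x + (y + s))) \<partial>P) \<partial>P) =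
      (\<integral>\<^sup>+y. (\<integral>\<^sup>+x. ennreal y * partial_sum_nn n (\<lambda>s. g (x + (y + s))) \<partial>P) \<partial>P)"
    by (rule pair_sigma_finite.Fubini') (auto intro!: pair_sigma_finite.intro sigma_finite_measure_axioms)
  also have "\<dots> = ?A"
  proof (rule nn_integral_cong)
    fix y
    have "(\<integral>\<^sup>+x. ennreal y * partial_sum_nn n (\<lambda>s. g (x + (y + s))) \<partial>P) =
       ennreal y * (\<integral>\<^sup>+x. partial_sum_nn n (\<lambda>s. g (y + (x + s))) \<partial>P)"
      by (subst nn_integral_cmult[symmetric]) (auto simp: add_ac)
    also have "(\<integral>\<^sup>+x. partial_sum_nn n (\<lambda>s. g (y + (x + s))) \<partial>P) = partial_sum_nn (Suc n) (\<lambda>s. g (y + s))"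
      by (subst partial_sum_nn_Suc) simp_all
    finally show "(\<integral>\<^sup>+x. ennreal y * partial_sum_nn n (\<lambda>s. g (x + (y + s))) \<partial>P) =
       ennreal y * partial_sum_nn (Suc n) (\<lambda>s. g (y + s))" .
  qed
  also have "?A + of_nat (Suc n) * ?A = of_nat (Suc (Suc n)) * ?A"
    by (simp add: distrib_right)
  finally show ?case .
qed

lemma measurable_poisson_sum[measurable]:
  "(\<lambda>(n, x). \<Sum>i<n. x i) \<in> borel_measurable (measure_pmf (poisson_pmf l) \<Otimes>\<^sub>M PiM UNIV (\<lambda>_::nat. P))"
proof -
  have "(\<lambda>(n, x). \<Sum>i<n. x i) \<in> borel_measurable (count_space UNIV \<Otimes>\<^sub>M PiM UNIV (\<lambda>_::nat. P))"
    by (rule measurable_pair_measure_countable1) auto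
  then show ?thesis
    by (rule measurable_cong_sets[THEN equalityD1, THEN subsetD, rotated 2])
       (auto intro!: sets_pair_measure_cong)
qed

lemma real_distribution_compound_poisson: "real_distribution (compound_poisson l P)"
proof -
  interpret pair_prob_space "measure_pmf (poisson_pmf l)" "PiM UNIV (\<lambda>_::nat. P)" ..
  interpret C: prob_space "compound_poisson l P"
    unfolding compound_poisson_def by (rule P.prob_space_distr) measurable
  show ?thesis by unfold_locales (auto simp: compound_poisson_def)
qed

lemma nn_integral_compound_poisson:
  assumes [measurable]: "g \<in> borel_measurable borel" and l: "0 < l"
  shows "(\<integral>\<^sup>+w. g w \<partial>compound_poisson l P) =
    (\<Sum>n. ennreal (l ^ n / fact n * exp (- l)) * partial_sum_nn n g)"
proof -
  have "(\<integral>\<^sup>+w. g w \<partial>compound_poisson l P) =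
     (\<integral>\<^sup>+z. g ((\<lambda>(n, x). \<Sum>i<n. x i) z) \<partial>(measure_pmf (poisson_pmf l) \<Otimes>\<^sub>M PiM UNIV (\<lambda>_::nat. P)))"
    unfolding compound_poisson_def by (rule nn_integral_distr) measurable
  also have "\<dots> = (\<integral>\<^sup>+n. partial_sum_nn n g \<partial>measure_pmf (poisson_pmf l))"
    by (subst seq.P.nn_integral_fst[symmetric]) (auto simp: partial_sum_nn_def)
  also have "\<dots> = (\<Sum>n. ennreal (l ^ n / fact n * exp (- l)) * partial_sum_nn n g)"
    using l by (simp add: nn_integral_measure_pmf nn_integral_count_space_nat poisson_pmf.rep_eq)
  finally show ?thesis .
qed

lemma AE_compound_poisson_nonneg: "0 < l \<Longrightarrow> AE w in compound_poisson l P. 0 \<le> w"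
proof -
  assume l: "0 < l"
  have "partial_sum_nn n (indicator {..<0}) = 0" for n
    unfolding partial_sum_nn_def
    by (subst nn_integral_0_iff_AE)
       (use AE_partial_sum_nonneg[of n] in \<open>auto elim!: eventually_mono split: split_indicator\<close>)
  then have "emeasure (compound_poisson l P) {..<0} = 0"
    using nn_integral_compound_poisson[of "indicator {..<0}" l] l
    by (simp add: compound_poisson_def)
  then show ?thesis
    by (intro AE_I[of _ _ "{..<0}"]) (auto simp: compound_poisson_def)
qed

text \<open>The Poisson weights satisfy \<open>(n + 1) p (n + 1) = l p n\<close>. This absorbs the
  factor \<open>n + 1\<close> produced by exchangeability and shifts the index back; the term
  \<open>n = 0\<close> vanishes because the empty sum is \<open>0\<close>.\<close>

lemma compound_poisson_size_bias:
  assumes [measurable]: "g \<in> borel_measurable borel" and l: "0 < l"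
  shows "(\<integral>\<^sup>+w. ennreal w * g w \<partial>compound_poisson l P) =
    ennreal l * (\<integral>\<^sup>+x. ennreal x * (\<integral>\<^sup>+w. g (x + w) \<partial>compound_poisson l P) \<partial>P)"
proof -
  note [measurable] = measurable_partial_sum_nn
  define p where "p n = l ^ n / fact n * exp (- l)" for n :: nat
  have p: "p n \<ge> 0" for n using l by (simp add: p_def)
  have ps: "p (Suc n) * real (Suc n) = l * p n" for n by (simp add: p_def field_simps del: of_nat_Suc)
  define F where "F n = ennreal (p n) * partial_sum_nn n (\<lambda>s. ennreal s * g s)" for n
  have F0: "F 0 = 0" by (simp add: F_def partial_sum_nn_0)
  have "(\<integral>\<^sup>+w. ennreal w * g w \<partial>compound_poisson l P) = (\<Sum>n. F n)"
    unfolding F_def p_def by (rule nn_integral_compound_poisson) (use l in auto)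
  also have "\<dots> = (\<Sum>n. F (n + 1)) + sum F {..<1}"
    by (rule suminf_offset) auto
  also have "\<dots> = (\<Sum>n. F (Suc n))" using F0 by simp
  also have "\<dots> = (\<Sum>n. ennreal l * (ennreal (p n) * (\<integral>\<^sup>+x. ennreal x * partial_sum_nn n (\<lambda>s. g (x + s)) \<partial>P)))"
  proof (rule suminf_cong)
    fix n
    have "F (Suc n) = ennreal (p (Suc n)) * ennreal (real (Suc n)) * (\<integral>\<^sup>+x. ennreal x * partial_sum_nn n (\<lambda>s. g (x + s)) \<partial>P)"
      by (simp add: F_def partial_sum_nn_size_bias ennreal_of_nat_eq_real_of_nat mult.assoc del: of_nat_Suc)
    also have "ennreal (p (Suc n)) * ennreal (real (Suc n)) = ennreal l * ennreal (p n)"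
      using p l by (simp only: ennreal_mult[symmetric] ps of_nat_0_le_iff)
    finally show "F (Suc n) = ennreal l * (ennreal (p n) * (\<integral>\<^sup>+x. ennreal x * partial_sum_nn n (\<lambda>s. g (x + s)) \<partial>P))"
      by (simp add: mult.assoc)
  qed
  also have "\<dots> = ennreal l * (\<Sum>n. ennreal (p n) * (\<integral>\<^sup>+x. ennreal x * partial_sum_nn n (\<lambda>s. g (x + s)) \<partial>P))"
    by (rule ennreal_suminf_cmult)
  also have "(\<Sum>n. ennreal (p n) * (\<integral>\<^sup>+x. ennreal x * partial_sum_nn n (\<lambda>s. g (x + s)) \<partial>P)) =
     (\<Sum>n. (\<integral>\<^sup>+x. ennreal x * (ennreal (p n) * partial_sum_nn n (\<lambda>s. g (x + s))) \<partial>P))"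
    by (intro suminf_cong, subst nn_integral_cmult[symmetric]) (auto simp: mult_ac)
  also have "\<dots> = (\<integral>\<^sup>+x. (\<Sum>n. ennreal x * (ennreal (p n) * partial_sum_nn n (\<lambda>s. g (x + s)))) \<partial>P)"
    by (rule nn_integral_suminf[symmetric]) measurable
  also have "\<dots> = (\<integral>\<^sup>+x. ennreal x * (\<integral>\<^sup>+w. g (x + w) \<partial>compound_poisson l P) \<partial>P)"
    by (intro nn_integral_cong)
       (simp add: nn_integral_compound_poisson l p_def ennreal_suminf_cmult)
  finally show ?thesis .
qed

end

section \<open>Size bias of the compound law and the Stein discrepancy\<close>

text \<open>A finite distance excludes the branch with value \<open>\<infinity>\<close> in the
  definition, so \<open>\<phi> / L\<close> is an admissible competitor in the supremum.\<close>

lemma wasserstein_dist_lipschitz: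
  assumes S: "real_distribution S" and T: "real_distribution T"
    and id: "integrable S (\<lambda>x. x)" and fin: "wasserstein_dist S T \<noteq> \<infinity>"
    and L: "L > 0" and lip: "\<And>x y. \<bar>\<phi> x - \<phi> y\<bar> \<le> L * \<bar>x - y\<bar>"
    and int: "integrable S \<phi>" "integrable T \<phi>"
  shows "\<bar>(\<integral>x. \<phi> x \<partial>S) - (\<integral>x. \<phi> x \<partial>T)\<bar> \<le> L * enn2real (wasserstein_dist S T)"
proof -
  define g where "g x = \<phi> x / L" for x
  have "g \<in> {f. (\<forall>x y. \<bar>f x - f y\<bar> \<le> \<bar>x - y\<bar>) \<and> integrable S f \<and> integrable T f}"
    using lip L int by (auto simp: g_def[abs_def] diff_divide_distrib[symmetric] abs_divide pos_divide_le_eq mult.commute)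
  then have "ennreal \<bar>(\<integral>x. g x \<partial>S) - (\<integral>x. g x \<partial>T)\<bar> \<le> wasserstein_dist S T"
    using id fin unfolding wasserstein_dist_def by (auto intro: SUP_upper split: if_splits)
  then have "\<bar>(\<integral>x. g x \<partial>S) - (\<integral>x. g x \<partial>T)\<bar> \<le> enn2real (wasserstein_dist S T)"
    using fin by (metis abs_ge_zero enn2real_ennreal enn2real_mono infinity_ennreal_def less_top)
  moreover have "(\<integral>x. g x \<partial>S) - (\<integral>x. g x \<partial>T) = ((\<integral>x. \<phi> x \<partial>S) - (\<integral>x. \<phi> x \<partial>T)) / L"
    by (simp add: g_def diff_divide_distrib)
  ultimately show ?thesis using L by (simp add: abs_divide pos_divide_le_eq mult.commute)
qed

locale compound_poisson_law = nonneg_law +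
  fixes S :: "real measure" and l :: real
  assumes square_int: "integrable P (\<lambda>x. x\<^sup>2)" and var_pos: "0 < variance (\<lambda>x. x)"
    and size_biased: "size_biased P S" and l_pos: "0 < l"
begin

definition "m = expectation (\<lambda>x. x)"
text \<open>Equal to \<open>\<E> X^2 / \<E> X\<close>, and by the moment formulas below to the ratio
  of variance to mean of \<open>Q\<close>, that is, to \<open>1 / \<alpha>\<close>.\<close>

definition "mS = (\<integral>y. y \<partial>S)"
abbreviation "Q \<equiv> compound_poisson l P"

sublocale S: real_distribution S
  using size_biased by (simp add: size_biased_def)

sublocale Q: real_distribution Q
  by (rule real_distribution_compound_poisson)

sublocale QS: pair_prob_space Q S ..

lemma total_mass [simp]: "emeasure Q UNIV = 1" "emeasure S UNIV = 1" "measure Q UNIV = 1" "measure S UNIV = 1"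
  using Q.emeasure_space_1 S.emeasure_space_1 Q.prob_space S.prob_space by auto

lemma size_biasedD:
  assumes "f \<in> borel_measurable borel" "integrable P (\<lambda>v. v * f v)"
  shows "integrable S f" "(\<integral>v. v * f v \<partial>P) = m * (\<integral>v. f v \<partial>S)"
  using size_biased assms by (auto simp: size_biased_def m_def)

lemma integrable_id: "integrable P (\<lambda>x. x)"
  by (rule square_integrable_imp_integrable[OF _ square_int]) simp

lemma integrable_S_id: "integrable S (\<lambda>x. x)"
  using size_biasedD(1)[of "\<lambda>v. v"] square_int by (simp add: power2_eq_square)

lemma second_moment: "expectation (\<lambda>x. x\<^sup>2) = m * mS"
  using size_biasedD(2)[of "\<lambda>v. v"] square_int by (simp add: power2_eq_square mS_def)

lemma m_nonneg: "m \<ge> 0"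
  unfolding m_def by (rule integral_nonneg_AE) (rule nonneg)

lemma m_pos: "m > 0" and mS_pos: "mS > 0"
proof -
  have "expectation (\<lambda>x. x\<^sup>2) > 0"
    using var_pos variance_eq[OF integrable_id square_int] zero_le_power2[of "expectation (\<lambda>x. x)"] by linarith
  then show "m > 0" "mS > 0"
    using second_moment m_nonneg by (auto simp: zero_less_mult_iff)
qed

text \<open>The defining property speaks of integrable real functions. Indicators turn it into the
  identity of measures \<open>x P(dx) = m S(dx)\<close>, which then holds against every nonnegative
  Borel function.\<close>

lemma nn_integral_size_biased:
  assumes g[measurable]: "g \<in> borel_measurable borel"
  shows "(\<integral>\<^sup>+x. ennreal x * g x \<partial>P) = ennreal m * (\<integral>\<^sup>+y. g y \<partial>S)"
proof -
  have "density P (\<lambda>x. ennreal x) = scale_measure (ennreal m) S"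
  proof (rule measure_eqI)
    fix A assume "A \<in> sets (density P (\<lambda>x. ennreal x))"
    then have A[measurable]: "A \<in> sets borel" by simp
    have i: "integrable P (\<lambda>x. x * indicator A x)"
      by (rule integrable_real_mult_indicator[OF _ integrable_id]) simp
    have "emeasure (density P (\<lambda>x. ennreal x)) A = (\<integral>\<^sup>+x. ennreal (x * indicator A x) \<partial>P)"
      by (subst emeasure_density) (auto intro!: nn_integral_cong split: split_indicator)
    also have "\<dots> = ennreal (\<integral>x. x * indicator A x \<partial>P)"
      by (rule nn_integral_eq_integral[OF i]) (use nonneg in \<open>auto split: split_indicator\<close>)
    also have "(\<integral>x. x * indicator A x \<partial>P) = m * measure S A"
      using size_biasedD(2)[OF _ i] by simp
    finally show "emeasure (density P (\<lambda>x. ennreal x)) A = emeasure (scale_measure (ennreal m) S) A"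
      using m_nonneg by (simp add: S.emeasure_eq_measure ennreal_mult)
  qed simp
  from arg_cong[OF this, of "\<lambda>M. nn_integral M g"] show ?thesis
    by (simp add: nn_integral_density nn_integral_scale_measure)
qed

lemma AE_S_nonneg: "AE y in S. 0 \<le> y"
proof -
  have "(\<integral>\<^sup>+x. ennreal x * indicator {..<0} x \<partial>P) = 0"
    by (rule nn_integral_zero') (auto split: split_indicator simp: ennreal_neg)
  then have "emeasure S {..<0} = 0"
    using nn_integral_size_biased[of "indicator {..<0}"] m_pos by simp
  then show ?thesis by (intro AE_I[of _ _ "{..<0}"]) auto
qed

lemma AE_Q_nonneg: "AE w in Q. 0 \<le> w"
  by (rule AE_compound_poisson_nonneg[OF l_pos])

lemma nn_integral_Q_size_biased:
  assumes [measurable]: "g \<in> borel_measurable borel"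
  shows "(\<integral>\<^sup>+w. ennreal w * g w \<partial>Q) = ennreal (l * m) * (\<integral>\<^sup>+y. (\<integral>\<^sup>+w. g (y + w) \<partial>Q) \<partial>S)"
proof -
  have "(\<lambda>y. \<integral>\<^sup>+w. g (y + w) \<partial>Q) \<in> borel_measurable borel"
    by measurable
  then show ?thesis
    using l_pos m_nonneg
    by (simp add: compound_poisson_size_bias nn_integral_size_biased ennreal_mult mult.assoc)
qed

definition R :: "real measure" where
  "R = distr (Q \<Otimes>\<^sub>M S) borel (\<lambda>(w, y). w + y)"

text \<open>An identity of measures carries the size bias of \<open>W\<close> from nonnegative
  functions to signed ones: \<open>R\<close>, the law of \<open>W + X^s\<close> with independent
  terms, is the size-biased law of \<open>Q\<close>.\<close>

lemma density_Q: "density Q (\<lambda>w. ennreal w) = density R (\<lambda>_. ennreal (l * m))"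
proof (rule measure_eqI)
  fix A assume "A \<in> sets (density Q (\<lambda>w. ennreal w))"
  then have A[measurable]: "A \<in> sets borel" by simp
  have "emeasure (density Q (\<lambda>w. ennreal w)) A = ennreal (l * m) * (\<integral>\<^sup>+y. (\<integral>\<^sup>+w. indicator A (y + w) \<partial>Q) \<partial>S)"
    by (subst emeasure_density) (auto simp: nn_integral_Q_size_biased)
  also have "(\<integral>\<^sup>+y. (\<integral>\<^sup>+w. indicator A (y + w) \<partial>Q) \<partial>S) = (\<integral>\<^sup>+z. indicator A (fst z + snd z) \<partial>(Q \<Otimes>\<^sub>M S))"
    by (subst QS.nn_integral_snd[symmetric]) (auto simp: add.commute)
  also have "\<dots> = (\<integral>\<^sup>+x. indicator A x \<partial>R)"
    unfolding R_def by (subst nn_integral_distr) (auto simp: split_beta)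
  also have "ennreal (l * m) * (\<integral>\<^sup>+x. indicator A x \<partial>R) = emeasure (density R (\<lambda>_. ennreal (l * m))) A"
    by (subst emeasure_density) (auto simp: R_def nn_integral_cmult)
  finally show "emeasure (density Q (\<lambda>w. ennreal w)) A = emeasure (density R (\<lambda>_. ennreal (l * m))) A" .
qed (simp add: R_def)

lemma integral_Q_size_biased:
  fixes g :: "real \<Rightarrow> real"
  assumes g[measurable]: "g \<in> borel_measurable borel" and B: "\<And>x. \<bar>g x\<bar> \<le> B"
  shows "(\<integral>w. w * g w \<partial>Q) = l * m * (\<integral>w. (\<integral>y. g (w + y) \<partial>S) \<partial>Q)"
proof -
  have "(\<integral>w. w * g w \<partial>Q) = (\<integral>w. g w \<partial>density Q (\<lambda>w. ennreal w))"
    by (subst integral_density) (use AE_Q_nonneg in auto)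
  also have "\<dots> = (\<integral>w. g w \<partial>density R (\<lambda>_. ennreal (l * m)))" by (simp only: density_Q)
  also have "\<dots> = (\<integral>w. (l * m) *\<^sub>R g w \<partial>R)"
    by (rule integral_density) (use l_pos m_nonneg in \<open>auto simp: R_def\<close>)
  also have "\<dots> = l * m * (\<integral>w. g w \<partial>R)" by simp
  also have "(\<integral>w. g w \<partial>R) = (\<integral>z. g (case z of (w, y) \<Rightarrow> w + y) \<partial>(Q \<Otimes>\<^sub>M S))"
    unfolding R_def by (rule integral_distr) auto
  also have "\<dots> = (\<integral>w. (\<integral>y. g (w + y) \<partial>S) \<partial>Q)"
  proof -
    have "integrable (Q \<Otimes>\<^sub>M S) (\<lambda>(w, y). g (w + y))"
      by (rule QS.P.integrable_const_bound[of _ B]) (use B in auto)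
    from QS.integral_fst[OF this] show ?thesis by (simp add: case_prod_unfold)
  qed
  finally show ?thesis .
qed

lemma nn_first_moment_Q: "(\<integral>\<^sup>+w. ennreal w \<partial>Q) = ennreal (l * m)"
  using nn_integral_Q_size_biased[of "\<lambda>_. 1"] by simp

lemma integrable_Q_id: "integrable Q (\<lambda>w. w)"
  by (rule integrableI_nn_integral_finite[OF _ AE_Q_nonneg nn_first_moment_Q]) simp

lemma expectation_Q: "(\<integral>w. w \<partial>Q) = l * m"
  using integral_Q_size_biased[of "\<lambda>_. 1" 1] by simp

text \<open>Size bias with the identity as test function:
  \<open>\<E> W^2 = l m (\<E> X^s + \<E> W)\<close>.\<close>

lemma nn_second_moment_Q: "(\<integral>\<^sup>+w. ennreal (w\<^sup>2) \<partial>Q) = ennreal (l * m * (mS + l * m))"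
proof -
  have nnS: "(\<integral>\<^sup>+y. ennreal y \<partial>S) = ennreal mS"
    unfolding mS_def by (rule nn_integral_eq_integral[OF integrable_S_id AE_S_nonneg])
  have "(\<integral>\<^sup>+w. ennreal (w\<^sup>2) \<partial>Q) = (\<integral>\<^sup>+w. ennreal w * ennreal w \<partial>Q)"
    by (rule nn_integral_cong_AE) (use AE_Q_nonneg in \<open>auto simp: ennreal_mult power2_eq_square\<close>)
  also have "\<dots> = ennreal (l * m) * (\<integral>\<^sup>+y. (\<integral>\<^sup>+w. ennreal (y + w) \<partial>Q) \<partial>S)"
    by (rule nn_integral_Q_size_biased) simp
  also have "(\<integral>\<^sup>+y. (\<integral>\<^sup>+w. ennreal (y + w) \<partial>Q) \<partial>S) = (\<integral>\<^sup>+y. ennreal y + ennreal (l * m) \<partial>S)"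
  proof (rule nn_integral_cong_AE, rule AE_mp[OF AE_S_nonneg], rule AE_I2, rule impI)
    fix y :: real assume y: "0 \<le> y"
    have "(\<integral>\<^sup>+w. ennreal (y + w) \<partial>Q) = (\<integral>\<^sup>+w. ennreal y + ennreal w \<partial>Q)"
      by (rule nn_integral_cong_AE) (use AE_Q_nonneg y in auto)
    also have "\<dots> = ennreal y + ennreal (l * m)"
      by (subst nn_integral_add) (auto simp: nn_first_moment_Q)
    finally show "(\<integral>\<^sup>+w. ennreal (y + w) \<partial>Q) = ennreal y + ennreal (l * m)" .
  qed
  also have "\<dots> = ennreal mS + ennreal (l * m)"
    by (subst nn_integral_add) (auto simp: nnS)
  finally show ?thesis
    using l_pos m_pos mS_pos by (simp add: ennreal_mult ennreal_plus)
qed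

lemma variance_Q: "Q.variance (\<lambda>w. w) = l * m * mS"
proof -
  have nn: "0 \<le> l * m * (mS + l * m)" using l_pos m_pos mS_pos by simp
  have i: "integrable Q (\<lambda>w. w\<^sup>2)"
    by (rule integrableI_nn_integral_finite[OF _ _ nn_second_moment_Q]) auto
  have "(\<integral>w. w\<^sup>2 \<partial>Q) = l * m * (mS + l * m)"
    by (subst integral_eq_nn_integral) (use nn in \<open>auto simp: nn_second_moment_Q\<close>)
  then show ?thesis
    using Q.variance_eq[OF integrable_Q_id i] by (simp add: expectation_Q power2_eq_square algebra_simps)
qed

text \<open>Size bias rewrites the density of \<open>X\<close>-tilde at \<open>t \<ge> 0\<close> as
  \<open>S {t..} / mS\<close>, the normalised tail of \<open>X^s\<close>; Fubini turns integration
  against a tail into an inner integral over \<open>[0, y]\<close>.\<close>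

lemma nn_integral_tilde:
  assumes [measurable]: "g \<in> borel_measurable borel"
  shows "(\<integral>\<^sup>+t. g t \<partial>tilde_dist P) =
    ennreal (1 / mS) * (\<integral>\<^sup>+y. (\<integral>\<^sup>+t. g t * indicator {0..y} t \<partial>lborel) \<partial>S)"
proof -
  interpret LS: pair_sigma_finite lborel S ..
  have dens: "ennreal (if t \<ge> 0 then 1 / (\<integral>x. x\<^sup>2 \<partial>P) * (\<integral>x. x * indicator {t..} x \<partial>P) else 0)
     = ennreal (1 / mS) * (\<integral>\<^sup>+y. (if 0 \<le> t \<and> t \<le> y then 1 else 0) \<partial>S)" for t
  proof (cases "t \<ge> 0")
    case True
    have "integrable P (\<lambda>x. x * indicator {t..} x)"
      by (rule integrable_real_mult_indicator[OF _ integrable_id]) simp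
    from size_biasedD(2)[OF _ this] have "(\<integral>x. x * indicator {t..} x \<partial>P) = m * measure S {t..}" by simp
    moreover have "(\<integral>\<^sup>+y. (if 0 \<le> t \<and> t \<le> y then 1 else 0) \<partial>S) = emeasure S {t..}"
    proof -
      have "(\<integral>\<^sup>+y. (if 0 \<le> t \<and> t \<le> y then 1 else 0) \<partial>S) = (\<integral>\<^sup>+y. indicator {t..} y \<partial>S)"
        using True by (intro nn_integral_cong) (auto split: split_indicator)
      then show ?thesis by simp
    qed
    ultimately show ?thesis
      using True m_pos mS_pos
      by (simp add: second_moment S.emeasure_eq_measure ennreal_mult[symmetric])
  qed simp
  have "(\<integral>\<^sup>+t. g t \<partial>tilde_dist P) =
     (\<integral>\<^sup>+t. ennreal (1 / mS) * (\<integral>\<^sup>+y. (if 0 \<le> t \<and> t \<le> y then 1 else 0) \<partial>S) * g t \<partial>lborel)"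
    unfolding tilde_dist_def dens by (rule nn_integral_density) measurable
  also have "\<dots> = ennreal (1 / mS) * (\<integral>\<^sup>+t. (\<integral>\<^sup>+y. g t * (if 0 \<le> t \<and> t \<le> y then 1 else 0) \<partial>S) \<partial>lborel)"
    by (subst nn_integral_cmult[symmetric])
       (auto simp: nn_integral_cmult mult_ac intro!: nn_integral_cong)
  also have "(\<integral>\<^sup>+t. (\<integral>\<^sup>+y. g t * (if 0 \<le> t \<and> t \<le> y then 1 else 0) \<partial>S) \<partial>lborel) =
     (\<integral>\<^sup>+y. (\<integral>\<^sup>+t. g t * (if 0 \<le> t \<and> t \<le> y then 1 else 0) \<partial>lborel) \<partial>S)"
    by (rule LS.Fubini'[symmetric]) measurable
  also have "\<dots> = (\<integral>\<^sup>+y. (\<integral>\<^sup>+t. g t * indicator {0..y} t \<partial>lborel) \<partial>S)"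
    by (intro nn_integral_cong) (auto split: split_indicator)
  finally show ?thesis .
qed

lemma real_distribution_tilde: "real_distribution (tilde_dist P)"
proof -
  have "(\<integral>\<^sup>+y. (\<integral>\<^sup>+t. 1 * indicator {0..y} t \<partial>lborel) \<partial>S) = (\<integral>\<^sup>+y. ennreal y \<partial>S)"
    by (rule nn_integral_cong_AE) (use AE_S_nonneg in auto)
  also have "\<dots> = ennreal mS"
    unfolding mS_def by (rule nn_integral_eq_integral[OF integrable_S_id AE_S_nonneg])
  finally have "(\<integral>\<^sup>+t. 1 \<partial>tilde_dist P) = 1"
    using nn_integral_tilde[of "\<lambda>_. 1"] mS_pos by (simp add: ennreal_mult[symmetric])
  then have "prob_space (tilde_dist P)" by (intro prob_spaceI) simp
  then interpret T: prob_space "tilde_dist P" .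
  show ?thesis by unfold_locales (auto simp: tilde_dist_def)
qed

text \<open>The increment is the integral of \<open>f'(w + t)\<close> over
  \<open>0 \<le> t \<le> y\<close>; averaging over \<open>S\<close> gives the tail density.
  Truncation by \<open>max 0\<close> makes the functions bounded on the whole line and changes
  nothing where the laws live.\<close>

lemma size_biased_increment:
  fixes f f' :: "real \<Rightarrow> real"
  assumes f: "\<And>x. (f has_real_derivative f' x) (at x)"
    and cont: "continuous_on UNIV f'"
    and B: "\<And>x. 0 \<le> x \<Longrightarrow> \<bar>f x\<bar> \<le> B" "\<And>x. 0 \<le> x \<Longrightarrow> \<bar>f' x\<bar> \<le> B"
    and w: "0 \<le> w"
  shows "(\<integral>y. f (max 0 (w + y)) \<partial>S) - f w = mS * (\<integral>t. f' (max 0 (w + t)) \<partial>tilde_dist P)"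
proof -
  interpret T: real_distribution "tilde_dist P" by (rule real_distribution_tilde)
  have B0: "B \<ge> 0" using B(1)[of 0] by simp
  have "continuous_on UNIV f"
    by (rule DERIV_continuous_on) (rule has_field_derivative_at_within[OF f])
  with cont have [measurable]: "f \<in> borel_measurable borel" "f' \<in> borel_measurable borel"
    by (auto intro: borel_measurable_continuous_onI)
  \<comment> \<open>Adding \<open>B\<close> makes the integrand nonnegative, as the extended
    identity for \<open>X\<close>-tilde requires. It contributes \<open>B * y\<close> inside the
    integral over \<open>S\<close> and cancels at the end.\<close>
  define \<phi> where "\<phi> t = f' (max 0 (w + t)) + B" for t
  have \<phi>_bd: "\<bar>f' (max 0 (w + t))\<bar> \<le> B" for t by (rule B(2)) simp
  have \<phi>_nn: "0 \<le> \<phi> t" for t using \<phi>_bd[of t] by (simp add: \<phi>_def abs_le_iff)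
  have if': "integrable (tilde_dist P) (\<lambda>t. f' (max 0 (w + t)))"
    by (rule T.integrable_const_bound[of _ B]) (use \<phi>_bd in auto)
  have "ennreal (\<integral>t. \<phi> t \<partial>tilde_dist P) = (\<integral>\<^sup>+t. ennreal (\<phi> t) \<partial>tilde_dist P)"
    by (rule nn_integral_eq_integral[symmetric]) (use if' \<phi>_nn in \<open>auto simp: \<phi>_def\<close>)
  also have "\<dots> = ennreal (1 / mS) * (\<integral>\<^sup>+y. (\<integral>\<^sup>+t. ennreal (\<phi> t) * indicator {0..y} t \<partial>lborel) \<partial>S)"
    by (rule nn_integral_tilde) (simp add: \<phi>_def)
  also have "(\<integral>\<^sup>+y. (\<integral>\<^sup>+t. ennreal (\<phi> t) * indicator {0..y} t \<partial>lborel) \<partial>S)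
      = (\<integral>\<^sup>+y. ennreal (f (max 0 (w + y)) - f w + B * y) \<partial>S)"
  proof (rule nn_integral_cong_AE, rule AE_mp[OF AE_S_nonneg], rule AE_I2, rule impI)
    fix y :: real assume y: "0 \<le> y"
    have "(\<integral>\<^sup>+t. ennreal (\<phi> t) * indicator {0..y} t \<partial>lborel) = ennreal ((f (w + y) + B * y) - (f (w + 0) + B * 0))"
    proof (rule nn_integral_FTC_Icc)
      fix t :: real assume t: "t \<in> {0..y}"
      have "((\<lambda>t. f (w + t)) has_real_derivative f' (w + t)) (at t)"
        using f[of "t + w"] by (simp add: DERIV_shift add.commute)
      then show "((\<lambda>t. f (w + t) + B * t) has_real_derivative \<phi> t) (at t)"
        using t w by (auto intro!: derivative_eq_intros simp: \<phi>_def)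
    qed (use y \<phi>_nn in \<open>auto simp: \<phi>_def\<close>)
    then show "(\<integral>\<^sup>+t. ennreal (\<phi> t) * indicator {0..y} t \<partial>lborel) = ennreal (f (max 0 (w + y)) - f w + B * y)"
      using y w by (simp add: algebra_simps)
  qed
  finally have nn: "ennreal (\<integral>t. \<phi> t \<partial>tilde_dist P) = ennreal (1 / mS) * (\<integral>\<^sup>+y. ennreal (f (max 0 (w + y)) - f w + B * y) \<partial>S)" .
  have iS: "integrable S (\<lambda>y. f (max 0 (w + y)))"
    by (rule S.integrable_const_bound[of _ B]) (use B(1) in auto)
  have int: "integrable S (\<lambda>y. f (max 0 (w + y)) - f w + B * y)" using iS integrable_S_id by simp
  have nonneg: "AE y in S. 0 \<le> f (max 0 (w + y)) - f w + B * y"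
  proof (rule AE_mp[OF AE_S_nonneg], rule AE_I2, rule impI)
    fix y :: real assume y: "0 \<le> y"
    have "\<bar>f (w + y) - f w\<bar> \<le> B * \<bar>(w + y) - w\<bar>"
      using field_differentiable_bound[of "{0..}" f f' B "w + y" w] f B(2) w y
      by (simp add: has_field_derivative_at_within)
    then show "0 \<le> f (max 0 (w + y)) - f w + B * y" using w y by (simp add: abs_le_iff)
  qed
  have nnS: "(\<integral>\<^sup>+y. ennreal (f (max 0 (w + y)) - f w + B * y) \<partial>S) = ennreal (\<integral>y. f (max 0 (w + y)) - f w + B * y \<partial>S)"
    "0 \<le> (\<integral>y. f (max 0 (w + y)) - f w + B * y \<partial>S)"
    by (rule nn_integral_eq_integral[OF int nonneg], rule integral_nonneg_AE[OF nonneg])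
  have "(\<integral>y. f (max 0 (w + y)) - f w + B * y \<partial>S) = (\<integral>y. f (max 0 (w + y)) \<partial>S) - f w + B * mS"
    using iS integrable_S_id by (simp add: mS_def)
  moreover have "(\<integral>t. \<phi> t \<partial>tilde_dist P) = (\<integral>t. f' (max 0 (w + t)) \<partial>tilde_dist P) + B"
    using if' by (simp add: \<phi>_def T.prob_space[unfolded T.space_eq_univ])
  moreover have "(\<integral>t. \<phi> t \<partial>tilde_dist P) = (1 / mS) * (\<integral>y. f (max 0 (w + y)) - f w + B * y \<partial>S)"
  proof -
    have "0 \<le> (\<integral>t. \<phi> t \<partial>tilde_dist P)" using \<phi>_nn by simp
    then show ?thesis
      using nn nnS mS_pos by (simp add: ennreal_mult[symmetric] del: ennreal_1)
  qed
  ultimately show ?thesis using mS_pos by (simp add: field_simps)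
qed

lemma stein_discrepancy:
  fixes f f' :: "real \<Rightarrow> real"
  assumes f: "\<And>x. (f has_real_derivative f' x) (at x)"
    and cont: "continuous_on UNIV f'"
    and B: "\<And>x. 0 \<le> x \<Longrightarrow> \<bar>f x\<bar> \<le> B" "\<And>x. 0 \<le> x \<Longrightarrow> \<bar>f' x\<bar> \<le> B"
    and L: "L > 0" "\<And>x y. 0 \<le> x \<Longrightarrow> 0 \<le> y \<Longrightarrow> \<bar>f' x - f' y\<bar> \<le> L * \<bar>x - y\<bar>"
    and fin: "wasserstein_dist S (tilde_dist P) \<noteq> \<infinity>"
  shows "\<bar>\<integral>w. w * f' w + (l * m / mS - 1 / mS * w) * f w \<partial>Q\<bar>
    \<le> l * m * L * enn2real (wasserstein_dist S (tilde_dist P))"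
proof -
  let ?\<theta> = "enn2real (wasserstein_dist S (tilde_dist P))"
  interpret T: real_distribution "tilde_dist P" by (rule real_distribution_tilde)
  have "continuous_on UNIV f"
    by (rule DERIV_continuous_on) (rule has_field_derivative_at_within[OF f])
  with cont have [measurable]: "f \<in> borel_measurable borel" "f' \<in> borel_measurable borel"
    by (auto intro: borel_measurable_continuous_onI)
  \<comment> \<open>Bounds are available only on the half-line, but Wasserstein test functions live
    on the real line; freezing the value at \<open>0\<close> preserves both the bound and the
    Lipschitz constant.\<close>
  define \<psi> where "\<psi> w = f (max 0 w)" for w
  define \<phi> where "\<phi> w = f' (max 0 w)" for w
  have bd: "\<bar>\<psi> w\<bar> \<le> B" "\<bar>\<phi> w\<bar> \<le> B" for w unfolding \<psi>_def \<phi>_def by (rule B; simp)+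
  have [measurable]: "\<psi> \<in> borel_measurable borel" "\<phi> \<in> borel_measurable borel"
    unfolding \<psi>_def \<phi>_def by measurable
  have lip: "\<bar>\<phi> x - \<phi> y\<bar> \<le> L * \<bar>x - y\<bar>" for x y
  proof -
    have "\<bar>\<phi> x - \<phi> y\<bar> \<le> L * \<bar>max 0 x - max 0 y\<bar>" unfolding \<phi>_def by (rule L(2)) auto
    also have "\<dots> \<le> L * \<bar>x - y\<bar>" using L(1) by (intro mult_left_mono) auto
    finally show ?thesis .
  qed
  have iS: "integrable S (\<lambda>y. \<psi> (w + y))" "integrable S (\<lambda>y. \<phi> (w + y))"
    "integrable (tilde_dist P) (\<lambda>y. \<phi> (w + y))" for w
    by (intro S.integrable_const_bound[of _ B] T.integrable_const_bound[of _ B]; use bd in auto)+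
  have iQ: "integrable Q \<psi>" "integrable Q (\<lambda>w. \<integral>y. \<psi> (w + y) \<partial>S)" "integrable Q (\<lambda>w. \<integral>y. \<phi> (w + y) \<partial>S)"
    "integrable Q (\<lambda>w. \<integral>y. \<phi> (w + y) \<partial>tilde_dist P)"
  proof -
    show "integrable Q \<psi>" by (rule Q.integrable_const_bound[of _ B]) (use bd in auto)
    have "\<bar>\<integral>y. \<psi> (w + y) \<partial>S\<bar> \<le> B" "\<bar>\<integral>y. \<phi> (w + y) \<partial>S\<bar> \<le> B" for w
      by (rule order.trans[OF integral_abs_bound S.integral_le_const]; use iS bd in auto)+
    then show "integrable Q (\<lambda>w. \<integral>y. \<psi> (w + y) \<partial>S)" "integrable Q (\<lambda>w. \<integral>y. \<phi> (w + y) \<partial>S)"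
      by (intro Q.integrable_const_bound[of _ B]; simp)+
    have "\<bar>\<integral>y. \<phi> (w + y) \<partial>tilde_dist P\<bar> \<le> B" for w
      by (rule order.trans[OF integral_abs_bound T.integral_le_const]; use iS bd in auto)+
    then show "integrable Q (\<lambda>w. \<integral>y. \<phi> (w + y) \<partial>tilde_dist P)"
      by (intro Q.integrable_const_bound[of _ B]; simp)+
  qed
  have iw: "integrable Q (\<lambda>w. w * g w)" if "g \<in> borel_measurable borel" "\<And>w. \<bar>g w\<bar> \<le> B" for g
  proof (rule Bochner_Integration.integrable_bound)
    show "integrable Q (\<lambda>w. B * w)" using integrable_Q_id by simp
    show "(\<lambda>w. w * g w) \<in> borel_measurable Q" using that(1) by simp
    have "\<bar>w\<bar> * \<bar>g w\<bar> \<le> \<bar>w\<bar> * \<bar>B\<bar>" for w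
      by (rule mult_left_mono) (use that(2)[of w] in auto)
    then show "AE w in Q. norm (w * g w) \<le> norm (B * w)"
      by (intro AE_I2) (simp add: abs_mult mult.commute)
  qed
  have iwQ: "integrable Q (\<lambda>w. w * \<psi> w)" "integrable Q (\<lambda>w. w * \<phi> w)"
    by (rule iw; use bd in simp)+
  have "(\<integral>w. w * f' w + (l * m / mS - 1 / mS * w) * f w \<partial>Q) =
    (\<integral>w. w * \<phi> w + l * m / mS * \<psi> w - 1 / mS * (w * \<psi> w) \<partial>Q)"
    by (rule integral_cong_AE) (use AE_Q_nonneg in \<open>auto simp: \<phi>_def \<psi>_def algebra_simps elim!: eventually_mono\<close>)
  also have "\<dots> = (\<integral>w. w * \<phi> w \<partial>Q) + l * m / mS * (\<integral>w. \<psi> w \<partial>Q) - 1 / mS * (\<integral>w. w * \<psi> w \<partial>Q)"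
    using iwQ iQ(1) by simp
  \<comment> \<open>Size bias is applied to both terms carrying a factor \<open>w\<close>. The
    coefficients \<open>l * m / mS\<close> and \<open>1 / mS\<close> combine so that
    \<open>\<psi>\<close> occurs only through an increment.\<close>
  also have "\<dots> = l * m * (\<integral>w. (\<integral>y. \<phi> (w + y) \<partial>S) - 1 / mS * ((\<integral>y. \<psi> (w + y) \<partial>S) - \<psi> w) \<partial>Q)"
    using iQ by (simp add: integral_Q_size_biased[OF _ bd(1)] integral_Q_size_biased[OF _ bd(2)] algebra_simps)
  also have "(\<integral>w. (\<integral>y. \<phi> (w + y) \<partial>S) - 1 / mS * ((\<integral>y. \<psi> (w + y) \<partial>S) - \<psi> w) \<partial>Q) =
     (\<integral>w. (\<integral>y. \<phi> (w + y) \<partial>S) - (\<integral>y. \<phi> (w + y) \<partial>tilde_dist P) \<partial>Q)"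
  proof (rule integral_cong_AE)
    show "AE w in Q. (\<integral>y. \<phi> (w + y) \<partial>S) - 1 / mS * ((\<integral>y. \<psi> (w + y) \<partial>S) - \<psi> w) =
      (\<integral>y. \<phi> (w + y) \<partial>S) - (\<integral>y. \<phi> (w + y) \<partial>tilde_dist P)"
    proof (rule AE_mp[OF AE_Q_nonneg], rule AE_I2, rule impI)
      fix w :: real assume w: "0 \<le> w"
      from size_biased_increment[OF f cont B w]
      show "(\<integral>y. \<phi> (w + y) \<partial>S) - 1 / mS * ((\<integral>y. \<psi> (w + y) \<partial>S) - \<psi> w) =
      (\<integral>y. \<phi> (w + y) \<partial>S) - (\<integral>y. \<phi> (w + y) \<partial>tilde_dist P)"
        using w mS_pos by (simp add: \<phi>_def \<psi>_def)
    qed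
  qed (use iQ in auto)
  also have "\<bar>l * m * (\<integral>w. (\<integral>y. \<phi> (w + y) \<partial>S) - (\<integral>y. \<phi> (w + y) \<partial>tilde_dist P) \<partial>Q)\<bar> \<le> l * m * (L * ?\<theta>)"
  proof -
    \<comment> \<open>The distance is used for each fixed \<open>w\<close>, with a translate of
      \<open>\<phi>\<close> as test function.\<close>
    have "\<bar>(\<integral>y. \<phi> (w + y) \<partial>S) - (\<integral>y. \<phi> (w + y) \<partial>tilde_dist P)\<bar> \<le> L * ?\<theta>" for w
    proof (rule wasserstein_dist_lipschitz[OF S.real_distribution_axioms real_distribution_tilde integrable_S_id fin L(1)])
      show "\<bar>\<phi> (w + x) - \<phi> (w + y)\<bar> \<le> L * \<bar>x - y\<bar>" for x y using lip[of "w + x" "w + y"] by simp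
    qed (use iS in auto)
    then have "\<bar>\<integral>w. (\<integral>y. \<phi> (w + y) \<partial>S) - (\<integral>y. \<phi> (w + y) \<partial>tilde_dist P) \<partial>Q\<bar> \<le> L * ?\<theta>"
      by (intro order.trans[OF integral_abs_bound Q.integral_le_const]) (use iQ in auto)
    then show ?thesis using l_pos m_pos by (simp add: abs_mult)
  qed
  finally show ?thesis by (simp add: mult.assoc)
qed

end

section \<open>Approximation bounds\<close>

lemma gamma_stein_equation:
  fixes h h' h'' :: "real \<Rightarrow> real"
  assumes pos: "r > 0" "\<alpha> > 0"
    and h: "\<And>x. (h has_real_derivative h' x) (at x)"
    and h': "\<And>x. (h' has_real_derivative h'' x) (at x)"
    and cont: "continuous_on UNIV h''"
    and B1: "\<And>x. \<bar>h' x\<bar> \<le> B1" and B2: "\<And>x. \<bar>h'' x\<bar> \<le> B2"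
  obtains f f' B where
    "\<And>x. (f has_real_derivative f' x) (at x)" "continuous_on UNIV f'"
    "\<forall>x\<ge>0. \<bar>f x\<bar> \<le> B" "\<forall>x\<ge>0. \<bar>f' x\<bar> \<le> B"
    "\<forall>x\<ge>0. \<forall>y\<ge>0. \<bar>f' x - f' y\<bar> \<le> (2 * B2 + 4 * \<alpha> * B1) / (r + 2) * \<bar>x - y\<bar>"
    "\<And>x. x * f' x + (r - \<alpha> * x) * f x = h x - (\<integral>t. h t \<partial>gamma_dist r \<alpha>)"
proof -
  interpret G: real_distribution "gamma_dist r \<alpha>" by (rule real_distribution_gamma_dist[OF pos])
  define c where "c = (\<integral>t. h t \<partial>gamma_dist r \<alpha>)"
  define L where "L = (2 * B2 + 4 * \<alpha> * B1) / (r + 2)"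
  have lip: "\<bar>h x - h y\<bar> \<le> B1 * \<bar>x - y\<bar>" for x y
    using field_differentiable_bound[of UNIV h h' B1 x y, OF convex_UNIV] h B1
    by (simp add: has_field_derivative_at_within)
  have ih: "integrable (gamma_dist r \<alpha>) h"
    by (rule G.integrable_lipschitz[OF integrable_gamma_dist_id[OF pos] lip])
  have mh: "(\<lambda>t. h t - c) \<in> borel_measurable borel"
    using borel_measurable_continuous_onI[OF lipschitz_continuous[OF lip]] by simp
  have int: "set_integrable lborel {0..} (\<lambda>t. t powr (r - 1) * exp (- \<alpha> * t) * (h t - c))"
    using integrable_gamma_dist_iff[OF pos mh] ih by simp
  have "(\<integral>t. h t - c \<partial>gamma_dist r \<alpha>) = 0"
    using ih G.prob_space by (simp add: c_def)
  then have zero: "(LINT t:{0..}|lborel. t powr (r - 1) * exp (- \<alpha> * t) * (h t - c)) = 0"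
    using integral_gamma_dist[OF pos mh] pos Gamma_real_pos[OF pos(1)] by simp
  have hc: "((\<lambda>x. h x - c) has_real_derivative h' x) (at x)" for x
    by (auto intro!: derivative_eq_intros h)
  obtain f f' f'' where f: "\<And>x. (f has_real_derivative f' x) (at x)"
    and f': "\<And>x. (f' has_real_derivative f'' x) (at x)"
    and f'': "continuous_on UNIV f''"
    and eq: "\<And>x. x * f' x + (r - \<alpha> * x) * f x = h x - c"
    by (rule gamma_stein_solution[OF pos(1) hc h' cont]) (rule that)
  note bounds = gamma_stein_bounds[OF h h' f f' f'' eq B1 B2 int zero pos]
  \<comment> \<open>The estimates hold for \<open>x > 0\<close> only; the values at \<open>0\<close>
    are included because of the atom of the compound law there.\<close>
  define B where "B = max (max \<bar>f 0\<bar> \<bar>f' 0\<bar>) (max (B1 / \<alpha>) (B2 / (2 * \<alpha>)))"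
  have lt: "\<bar>f' x - f' y\<bar> \<le> L * \<bar>x - y\<bar>" if xy: "0 \<le> x" "x < y" for x y
  proof -
    obtain z where z: "x < z" "f' y - f' x = (y - x) * f'' z"
      using MVT2[OF xy(2), of f' f''] f' by blast
    have "\<bar>f'' z\<bar> \<le> L" using bounds(3)[of z] z xy by (simp add: L_def)
    then have "\<bar>f' y - f' x\<bar> \<le> \<bar>y - x\<bar> * L" unfolding z(2) abs_mult by (intro mult_left_mono) auto
    then show ?thesis by (simp add: abs_minus_commute mult.commute)
  qed
  show thesis
  proof (rule that[of f f' B])
    show "continuous_on UNIV f'" by (rule DERIV_continuous_on) (rule has_field_derivative_at_within[OF f'])
    have "\<bar>f x\<bar> \<le> B" "\<bar>f' x\<bar> \<le> B" if "0 \<le> x" for x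
      using bounds(1,2)[of x] that by (cases "x = 0"; force simp: B_def max_def)+
    then show "\<forall>x\<ge>0. \<bar>f x\<bar> \<le> B" "\<forall>x\<ge>0. \<bar>f' x\<bar> \<le> B" by auto
    have "\<bar>f' x - f' y\<bar> \<le> L * \<bar>x - y\<bar>" if "0 \<le> x" "0 \<le> y" for x y
      using lt[of x y] lt[of y x] that
      by (cases x y rule: linorder_cases) (auto simp: abs_minus_commute)
    then show "\<forall>x\<ge>0. \<forall>y\<ge>0. \<bar>f' x - f' y\<bar> \<le> (2 * B2 + 4 * \<alpha> * B1) / (r + 2) * \<bar>x - y\<bar>"
      unfolding L_def by blast
  qed (use f eq in \<open>auto simp: c_def\<close>)
qed

section \<open>Gamma concentration, smoothed indicators and the choice of the width\<close>

text \<open>The left side is maximal at the mode \<open>y = r - 1\<close>; the inequality is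
  \<open>ln t \<le> t - 1\<close> at \<open>t = y / (r - 1)\<close>, multiplied by
  \<open>r - 1\<close> and exponentiated.\<close>

lemma gamma_kernel_le_mode:
  fixes r y :: real
  assumes "r > 1" "y > 0"
  shows "y powr (r - 1) * exp (- y) \<le> ((r - 1) / exp 1) powr (r - 1)"
proof -
  define s where "s = r - 1"
  have s: "s > 0" using assms by (simp add: s_def)
  have "ln (y / s) \<le> y / s - 1" by (rule ln_le_minus_one) (use s assms in auto)
  then have "s * (ln y - ln s) \<le> s * (y / s - 1)" using s assms by (simp add: ln_div)
  then have "s * ln y - y \<le> s * (ln s - 1)" using s by (simp add: algebra_simps)
  then have "exp (s * ln y - y) \<le> exp (s * (ln s - 1))" by simp
  also have "exp (s * ln y - y) = y powr s * exp (- y)"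
    using assms by (simp add: powr_def exp_diff exp_minus divide_inverse)
  also have "exp (s * (ln s - 1)) = (s / exp 1) powr s"
    using s by (simp add: powr_def ln_div)
  finally show ?thesis by (simp add: s_def)
qed

text \<open>The constant \<open>D\<close> in the bound of the gamma density by
  \<open>D x^(p - 1)\<close> with \<open>p = min r 1\<close>: the coefficient of the singularity at
  \<open>0\<close> if \<open>r < 1\<close>, the maximum of the density if
  \<open>r \<ge> 1\<close>.\<close>

definition density_coeff :: "real \<Rightarrow> real \<Rightarrow> real" where
  "density_coeff r \<alpha> = (if r < 1 then \<alpha> powr r / Gamma r else \<alpha> / Gamma r * mode_factor r)"

lemma density_coeff_pos: "r > 0 \<Longrightarrow> \<alpha> > 0 \<Longrightarrow> density_coeff r \<alpha> > 0"
  by (auto simp: density_coeff_def mode_factor_def Gamma_real_pos)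

lemma gamma_density_le:
  assumes r: "r > 0" "\<alpha> > 0" and x: "x > 0"
  shows "1 / Gamma r * \<alpha> powr r * x powr (r - 1) * exp (- \<alpha> * x)
    \<le> density_coeff r \<alpha> * x powr (min r 1 - 1)"
proof (cases "r < 1")
  case True
  have "1 / Gamma r * \<alpha> powr r * x powr (r - 1) * exp (- \<alpha> * x) \<le>
     1 / Gamma r * \<alpha> powr r * x powr (r - 1) * 1"
    using r x Gamma_real_pos[OF r(1)] by (intro mult_left_mono) auto
  then show ?thesis using True by (simp add: density_coeff_def)
next
  case False
  have "\<alpha> powr r = \<alpha> * \<alpha> powr (r - 1)" using r by (simp add: powr_diff)
  then have "1 / Gamma r * \<alpha> powr r * x powr (r - 1) * exp (- \<alpha> * x) =
      \<alpha> / Gamma r * ((\<alpha> * x) powr (r - 1) * exp (- (\<alpha> * x)))"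
    using r x by (simp add: powr_mult)
  also have "\<dots> \<le> \<alpha> / Gamma r * mode_factor r"
  proof (rule mult_left_mono)
    show "(\<alpha> * x) powr (r - 1) * exp (- (\<alpha> * x)) \<le> mode_factor r"
      using gamma_kernel_le_mode[of r "\<alpha> * x"] False r x by (cases "r = 1") (auto simp: mode_factor_def)
  qed (use r Gamma_real_pos[OF r(1)] in auto)
  finally show ?thesis using False x by (simp add: density_coeff_def)
qed

text \<open>The majorant \<open>D x^(p - 1)\<close> is nonincreasing, so an interval of given length
  carries most mass when it starts at \<open>0\<close>. The substitution \<open>x = a + u\<close>
  moves it there, and the integral of \<open>D u^(p - 1)\<close> is explicit.\<close>

lemma gamma_dist_concentration:
  assumes r: "r > 0" "\<alpha> > 0" and e: "\<epsilon> > 0"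
  shows "measure (gamma_dist r \<alpha>) {z<..z + \<epsilon>} \<le> density_coeff r \<alpha> * \<epsilon> powr (min r 1) / min r 1"
proof -
  interpret G: real_distribution "gamma_dist r \<alpha>" by (rule real_distribution_gamma_dist[OF r])
  define D where "D = density_coeff r \<alpha>"
  define p where "p = min r 1"
  define d where "d x = (if x > 0 then 1 / Gamma r * \<alpha> powr r * x powr (r - 1) * exp (- \<alpha> * x) else 0)" for x
  define a where "a = max z 0"
  have D: "D > 0" and p: "0 < p" "p \<le> 1" using density_coeff_pos[OF r] r by (auto simp: D_def p_def)
  have "emeasure (gamma_dist r \<alpha>) {z<..z + \<epsilon>} = (\<integral>\<^sup>+x. ennreal (d x) * indicator {z<..z + \<epsilon>} x \<partial>lborel)"
    unfolding gamma_dist_def d_def by (subst emeasure_density) auto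
  also have "\<dots> = ennreal \<bar>1\<bar> * (\<integral>\<^sup>+u. ennreal (d (a + 1 * u)) * indicator {z<..z + \<epsilon>} (a + 1 * u) \<partial>lborel)"
    by (rule nn_integral_real_affine) (auto simp: d_def)
  also have "\<dots> \<le> (\<integral>\<^sup>+u. ennreal (D * u powr (p - 1)) * indicator {0..\<epsilon>} u \<partial>lborel)"
    unfolding abs_one ennreal_1 mult_1
  proof (rule nn_integral_mono)
    fix u
    show "ennreal (d (a + u)) * indicator {z<..z + \<epsilon>} (a + u) \<le> ennreal (D * u powr (p - 1)) * indicator {0..\<epsilon>} u"
    proof (cases "a + u > 0 \<and> a + u \<in> {z<..z + \<epsilon>}")
      case True
      then have u: "0 < u" "u \<le> \<epsilon>" by (auto simp: a_def max_def split: if_splits)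
      have "d (a + u) \<le> D * (a + u) powr (p - 1)"
        unfolding d_def D_def p_def using gamma_density_le[OF r, of "a + u"] True by simp
      also have "\<dots> \<le> D * u powr (p - 1)"
        using D p u by (intro mult_left_mono powr_mono2') (auto simp: a_def)
      finally show ?thesis using True u by (simp add: ennreal_leI)
    qed (auto simp: d_def)
  qed
  also have "\<dots> = ennreal (D * (\<epsilon> powr p / p))"
  proof (rule nn_integral_has_integral_lebesgue')
    have "((\<lambda>x. x powr (p - 1)) has_integral (\<epsilon> powr (p - 1 + 1) / (p - 1 + 1))) {0..\<epsilon>}"
      by (rule has_integral_powr_from_0) (use p e in auto)
    from has_integral_mult_right[where c = D, OF this]
    show "((\<lambda>u. D * u powr (p - 1)) has_integral D * (\<epsilon> powr p / p)) {0..\<epsilon>}" by simp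
  qed (use D in auto)
  finally show ?thesis
    using D p by (simp add: G.emeasure_eq_measure ennreal_le_iff D_def p_def)
qed

lemma smooth_indicator:
  fixes z \<epsilon> :: real
  assumes e: "\<epsilon> > 0"
  obtains g g' g'' where
    "\<And>x. (g has_real_derivative g' x) (at x)"
    "\<And>x. (g' has_real_derivative g'' x) (at x)"
    "continuous_on UNIV g''"
    "\<And>x. \<bar>g' x\<bar> \<le> 2 / \<epsilon>" "\<And>x. \<bar>g'' x\<bar> \<le> 12 / \<epsilon>\<^sup>2"
    "\<And>x. 0 \<le> g x" "\<And>x. g x \<le> 1" "\<And>x. x \<le> z \<Longrightarrow> g x = 1" "\<And>x. z + \<epsilon> \<le> x \<Longrightarrow> g x = 0"
proof -
  \<comment> \<open>A ramp of slope \<open>2 / \<epsilon>\<close> between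
    \<open>z + \<epsilon> / 4\<close> and \<open>z + 3 * \<epsilon> / 4\<close>. The averaging
    widths \<open>\<epsilon> / 6\<close> and \<open>\<epsilon> / 12\<close> add up to the margin
    \<open>\<epsilon> / 4\<close> on each side, and the first gives
    \<open>(2 / \<epsilon>) / (\<epsilon> / 6) = 12 / \<epsilon>^2\<close>.\<close>
  define h where "h x = max 0 (min 1 (1 - 2 / \<epsilon> * (x - (z + \<epsilon> / 4))))" for x
  have lip: "\<bar>h x - h y\<bar> \<le> 2 / \<epsilon> * \<bar>x - y\<bar>" for x y
  proof -
    have "\<bar>h x - h y\<bar> \<le> \<bar>2 / \<epsilon> * (x - (z + \<epsilon> / 4)) - 2 / \<epsilon> * (y - (z + \<epsilon> / 4))\<bar>"
      unfolding h_def by linarith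
    also have "\<dots> = \<bar>2 / \<epsilon> * (x - y)\<bar>" by (simp add: right_diff_distrib)
    also have "\<dots> = 2 / \<epsilon> * \<bar>x - y\<bar>" unfolding abs_mult using e by simp
    finally show ?thesis .
  qed
  have hi: "h x = 1" if "x \<le> z + \<epsilon> / 4" for x
  proof -
    have "2 / \<epsilon> * (x - (z + \<epsilon> / 4)) \<le> 0" using that e by (intro mult_nonneg_nonpos) auto
    then show ?thesis by (simp add: h_def)
  qed
  have lo: "h x = 0" if "x \<ge> z + 3 * \<epsilon> / 4" for x
  proof -
    have "2 / \<epsilon> * (x - (z + \<epsilon> / 4)) \<ge> 2 / \<epsilon> * (\<epsilon> / 2)" using that e by (intro mult_left_mono) auto
    then show ?thesis using e by (simp add: h_def)
  qed
  obtain g g' g'' where g: "\<And>x. (g has_real_derivative g' x) (at x)"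
    "\<And>x. (g' has_real_derivative g'' x) (at x)" "continuous_on UNIV g''"
    "\<And>x. \<bar>g' x\<bar> \<le> 2 / \<epsilon>" and g2: "\<And>x. \<bar>g'' x\<bar> \<le> 2 / \<epsilon> / (\<epsilon> / 6)"
    and \<xi>: "\<And>x. \<exists>\<xi>. \<bar>\<xi> - x\<bar> < \<epsilon> / 6 + \<epsilon> / 12 \<and> g x = h \<xi>"
    by (rule smooth_lipschitz[OF lip, of "\<epsilon> / 6" "\<epsilon> / 12"]) (use e in auto)
  show thesis
  proof (rule that[OF g])
    fix x
    show "\<bar>g'' x\<bar> \<le> 12 / \<epsilon>\<^sup>2" using g2[of x] by (simp add: power2_eq_square)
    obtain \<xi> where \<xi>': "\<bar>\<xi> - x\<bar> < \<epsilon> / 4" "g x = h \<xi>" using \<xi>[of x] by auto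
    show "0 \<le> g x" "g x \<le> 1" unfolding \<xi>'(2) h_def by auto
    show "x \<le> z \<Longrightarrow> g x = 1" unfolding \<xi>'(2) using \<xi>'(1) by (intro hi) linarith
    show "z + \<epsilon> \<le> x \<Longrightarrow> g x = 0" unfolding \<xi>'(2) using \<xi>'(1) by (intro lo) linarith
  qed
qed

lemma cdf_smooth_indicator:
  assumes P: "real_distribution P" and g: "g \<in> borel_measurable borel" "\<And>x. 0 \<le> g x" "\<And>x. g x \<le> 1"
    and one: "\<And>x. x \<le> z \<Longrightarrow> g x = 1" and zero: "\<And>x. z + \<epsilon> \<le> x \<Longrightarrow> g x = (0::real)"
  shows "cdf P z \<le> (\<integral>x. g x \<partial>P)" "(\<integral>x. g x \<partial>P) \<le> cdf P (z + \<epsilon>)"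
proof -
  interpret P: real_distribution P by (rule P)
  have ig: "integrable P g"
    by (rule P.integrable_const_bound[of _ 1]) (use g in auto)
  have ii: "integrable P (indicator {..u} :: real \<Rightarrow> real)" for u by (simp add: P.emeasure_eq_measure)
  have "(\<integral>x. indicator {..z} x \<partial>P) \<le> (\<integral>x. g x \<partial>P)"
    by (rule integral_mono[OF ii ig]) (use g one in \<open>auto split: split_indicator\<close>)
  then show "cdf P z \<le> (\<integral>x. g x \<partial>P)" by (simp add: cdf_def)
  have "(\<integral>x. g x \<partial>P) \<le> (\<integral>x. indicator {..z + \<epsilon>} x \<partial>P)"
    by (rule integral_mono[OF ig ii]) (use g zero in \<open>auto split: split_indicator\<close>)
  then show "(\<integral>x. g x \<partial>P) \<le> cdf P (z + \<epsilon>)" by (simp add: cdf_def)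
qed

text \<open>The value \<open>\<epsilon> = (48 \<kappa> \<theta> / D) powr (1 / (p + 2))\<close> balances the first two terms.\<close>

lemma optimise_smoothing:
  fixes p D \<kappa> \<theta> \<alpha> y :: real
  assumes pos: "p > 0" "D > 0" "\<kappa> > 0" "\<theta> \<ge> 0" and
    y: "\<And>\<epsilon>. \<epsilon> > 0 \<Longrightarrow> y \<le> D * \<epsilon> powr p / p + \<kappa> * \<theta> * (24 / \<epsilon>\<^sup>2 + 8 * \<alpha> / \<epsilon>)"
  shows "y \<le> (1/2 + 1/p) * (48 * \<kappa>) powr (p / (p + 2)) * D powr (2 / (p + 2)) * \<theta> powr (p / (p + 2))
     + 8 * \<alpha> * \<kappa> powr ((p + 1) / (p + 2)) * (D / 48) powr (1 / (p + 2)) * \<theta> powr ((p + 1) / (p + 2))"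
proof (cases "\<theta> = 0")
  case True
  \<comment> \<open>The optimal width degenerates to \<open>0\<close> here, so the limit of small
    widths replaces it.\<close>
  have "((\<lambda>\<epsilon>. D * \<epsilon> powr p / p) \<longlongrightarrow> 0) (at_right 0)" using pos by real_asymp
  moreover have "\<forall>\<^sub>F \<epsilon> in at_right 0. y \<le> D * \<epsilon> powr p / p"
    using y True by (auto simp: eventually_at_right_field intro!: exI[of _ 1])
  ultimately have "y \<le> 0" by (rule tendsto_lowerbound) simp
  then show ?thesis using True by simp
next
  case False
  then have t: "\<theta> > 0" using pos by simp
  define q where "q = 1 / (p + 2)"
  define x where "x = 48 * \<kappa> * \<theta> / D"
  have x: "x > 0" using pos t by (simp add: x_def)
  have q: "q > 0" "p / (p + 2) = p * q" "2 / (p + 2) = 2 * q" "(p + 1) / (p + 2) = 1 - q" "1 / (p + 2) = q"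
    "1 - p * q = 2 * q" "1 - 2 * q = p * q"
    using pos by (auto simp: q_def field_simps)
  define \<epsilon> where "\<epsilon> = x powr q"
  have e: "\<epsilon> > 0" using x by (simp add: \<epsilon>_def)
  have ep: "\<epsilon> powr p = x powr (p * q)" by (simp add: \<epsilon>_def powr_powr mult.commute)
  \<comment> \<open>From \<open>\<epsilon>^(p + 2) = 48 \<kappa> \<theta> / D\<close> the term
    \<open>24 \<kappa> \<theta> / \<epsilon>^2\<close> is half of \<open>D \<epsilon>^p\<close>,
    which explains the factor \<open>1/2 + 1/p\<close>.\<close>
  have "\<epsilon>\<^sup>2 = x powr (2 * q)" using x by (simp add: \<epsilon>_def power2_eq_square powr_add[symmetric])
  then have "48 * \<kappa> * \<theta> / \<epsilon>\<^sup>2 = D * (x powr 1 / x powr (2 * q))" using x pos by (simp add: x_def)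
  also have "\<dots> = D * x powr (p * q)" by (simp only: powr_diff[symmetric] q(7))
  finally have e2: "\<kappa> * \<theta> * (24 / \<epsilon>\<^sup>2) = 1/2 * (D * x powr (p * q))" by simp
  have "D * x powr (p * q) = (48 * \<kappa>) powr (p * q) * \<theta> powr (p * q) * (D powr 1 / D powr (p * q))"
    using pos t by (simp add: x_def powr_mult powr_divide)
  also have "D powr 1 / D powr (p * q) = D powr (2 * q)" by (simp only: powr_diff[symmetric] q(6))
  finally have Dx: "D * x powr (p * q) = (48 * \<kappa>) powr (p * q) * D powr (2 * q) * \<theta> powr (p * q)" by simp
  have "\<kappa> * \<theta> * (8 * \<alpha> / \<epsilon>) = 8 * \<alpha> * (\<kappa> powr 1 / \<kappa> powr q) * (\<theta> powr 1 / \<theta> powr q) * (D / 48) powr q"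
    using pos t by (simp add: \<epsilon>_def x_def powr_mult powr_divide mult_ac)
  also have "\<dots> = 8 * \<alpha> * \<kappa> powr (1 - q) * (D / 48) powr q * \<theta> powr (1 - q)"
    by (simp only: powr_diff[symmetric] mult_ac)
  finally have e1: "\<kappa> * \<theta> * (8 * \<alpha> / \<epsilon>) = 8 * \<alpha> * \<kappa> powr (1 - q) * (D / 48) powr q * \<theta> powr (1 - q)" .
  have "y \<le> D * \<epsilon> powr p / p + \<kappa> * \<theta> * (24 / \<epsilon>\<^sup>2) + \<kappa> * \<theta> * (8 * \<alpha> / \<epsilon>)"
    using y[OF e] by (simp add: distrib_left)
  also have "\<dots> = (1/2 + 1/p) * (D * x powr (p * q)) + \<kappa> * \<theta> * (8 * \<alpha> / \<epsilon>)"
    unfolding e2 ep by (simp add: distrib_right)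
  finally show ?thesis unfolding e1 Dx q by (simp add: mult.assoc)
qed

text \<open>The case \<open>r \<ge> 1\<close> is the general formula at exponent \<open>1\<close>:
  \<open>48 = 8 * 6\<close>, the cube root of \<open>8\<close> is \<open>2\<close>, and
  \<open>(1/2 + 1) * 2 = 3\<close>.\<close>

lemma a_const_eq:
  assumes "r > 0" "\<alpha> > 0" "\<mu> > 0"
  shows "a_const \<mu> r \<alpha> = (1/2 + 1/min r 1) * (48 * (\<mu> / (r + 2))) powr (min r 1 / (min r 1 + 2))
     * density_coeff r \<alpha> powr (2 / (min r 1 + 2))"
proof (cases "r < 1")
  case False
  then have min: "min r 1 = 1" by simp
  have "(48 * (\<mu> / (r + 2))) powr (1/3) = (8 * (6 * \<mu> / (r + 2))) powr (1/3)" by simp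
  also have "\<dots> = 8 powr (1/3) * (6 * \<mu> / (r + 2)) powr (1/3)"
    using assms by (subst powr_mult) auto
  also have "8 powr (1/3) = (2 powr 3) powr (1/3 :: real)" by simp
  also have "\<dots> = 2" unfolding powr_powr by simp
  finally show ?thesis using False by (simp add: a_const_def density_coeff_def min)
qed (simp add: a_const_def density_coeff_def min_def)

text \<open>Again \<open>1/6 = 8/48\<close>: the cube root of \<open>8\<close> accounts for the
  change from \<open>4 * \<alpha>\<close> to \<open>8 * \<alpha>\<close>.\<close>

lemma b_const_eq:
  assumes "r > 0" "\<alpha> > 0" "\<mu> > 0"
  shows "b_const \<mu> r \<alpha> = 8 * \<alpha> * (\<mu> / (r + 2)) powr ((min r 1 + 1) / (min r 1 + 2))
     * (density_coeff r \<alpha> / 48) powr (1 / (min r 1 + 2))"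
proof (cases "r < 1")
  case False
  then have min: "min r 1 = 1" by simp
  have "(\<alpha> / (6 * Gamma r) * mode_factor r) powr (1/3) = (8 * (density_coeff r \<alpha> / 48)) powr (1/3)"
    using False by (simp add: density_coeff_def)
  also have "\<dots> = 8 powr (1/3) * (density_coeff r \<alpha> / 48) powr (1/3)"
    using density_coeff_pos[OF assms(1,2)] by (subst powr_mult) auto
  also have "8 powr (1/3) = (2 powr 3) powr (1/3 :: real)" by simp
  also have "\<dots> = 2" unfolding powr_powr by simp
  finally show ?thesis using False by (simp add: b_const_def min)
qed (simp add: b_const_def density_coeff_def min_def mult.commute)

section \<open>Wasserstein and Kolmogorov bounds for the compound Poisson law\<close>

context compound_poisson_law
begin

definition "alpha = 1 / mS"
definition "shape = l * m / mS"
abbreviation "theta \<equiv> enn2real (wasserstein_dist S (tilde_dist P))"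

lemma parameters_pos: "alpha > 0" "shape > 0" "l * m > 0"
  using l_pos m_pos mS_pos by (auto simp: alpha_def shape_def)

lemma smooth_test_bound:
  fixes h h' h'' :: "real \<Rightarrow> real"
  assumes fin: "wasserstein_dist S (tilde_dist P) \<noteq> \<infinity>"
    and h: "\<And>x. (h has_real_derivative h' x) (at x)"
    and h': "\<And>x. (h' has_real_derivative h'' x) (at x)"
    and cont: "continuous_on UNIV h''"
    and B1: "\<And>x. \<bar>h' x\<bar> \<le> B1" and B2: "\<And>x. \<bar>h'' x\<bar> \<le> B2" and B: "B1 > 0"
  shows "\<bar>(\<integral>x. h x \<partial>Q) - (\<integral>x. h x \<partial>gamma_dist shape alpha)\<bar>
    \<le> l * m / (shape + 2) * theta * (2 * B2 + 4 * alpha * B1)"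
proof -
  define c where "c = (\<integral>x. h x \<partial>gamma_dist shape alpha)"
  define L where "L = (2 * B2 + 4 * alpha * B1) / (shape + 2)"
  obtain f f' C where f: "\<And>x. (f has_real_derivative f' x) (at x)" "continuous_on UNIV f'"
    "\<forall>x\<ge>0. \<bar>f x\<bar> \<le> C" "\<forall>x\<ge>0. \<bar>f' x\<bar> \<le> C"
    "\<forall>x\<ge>0. \<forall>y\<ge>0. \<bar>f' x - f' y\<bar> \<le> L * \<bar>x - y\<bar>"
    and eq: "\<And>x. x * f' x + (shape - alpha * x) * f x = h x - c"
    unfolding c_def L_def
    by (rule gamma_stein_equation[OF parameters_pos(2,1) h h' cont B1 B2]) (rule that[unfolded c_def L_def])
  have "B2 \<ge> 0" using B2[of 0] by simp
  \<comment> \<open>Strict positivity allows test functions to be rescaled to Lipschitz constant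
    \<open>1\<close>.\<close>
  then have L: "L > 0" using B parameters_pos by (simp add: L_def add_nonneg_pos)
  have lip: "\<bar>h x - h y\<bar> \<le> B1 * \<bar>x - y\<bar>" for x y
    using field_differentiable_bound[of UNIV h h' B1 x y, OF convex_UNIV] h B1
    by (simp add: has_field_derivative_at_within)
  have ih: "integrable Q h" by (rule Q.integrable_lipschitz[OF integrable_Q_id lip])
  have "\<bar>\<integral>w. w * f' w + (shape - alpha * w) * f w \<partial>Q\<bar> \<le> l * m * L * theta"
    unfolding shape_def alpha_def by (rule stein_discrepancy[OF f(1,2) _ _ L _ fin]) (use f(3-5) in auto)
  also have "(\<integral>w. w * f' w + (shape - alpha * w) * f w \<partial>Q) = (\<integral>x. h x \<partial>Q) - c"
    unfolding eq using ih by simp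
  finally show ?thesis by (simp add: c_def L_def mult_ac)
qed

lemma wasserstein_test_bound:
  assumes fin: "wasserstein_dist S (tilde_dist P) \<noteq> \<infinity>"
    and g: "\<And>x y. \<bar>g x - g y\<bar> \<le> \<bar>x - y :: real\<bar>"
  shows "\<bar>(\<integral>x. g x \<partial>Q) - (\<integral>x. g x \<partial>gamma_dist shape alpha)\<bar>
    \<le> 8 * sqrt (3 * (l * m) / (shape + 2)) * theta powr (1/2) + 8 * shape / (shape + 2) * theta"
proof -
  interpret G: real_distribution "gamma_dist shape alpha"
    by (rule real_distribution_gamma_dist) (rule parameters_pos)+
  note iG = integrable_gamma_dist_id[OF parameters_pos(2,1)]
  define K where "K = l * m / (shape + 2) * theta"
  have K: "K \<ge> 0" using parameters_pos by (simp add: K_def less_imp_le)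
  define \<Delta> where "\<Delta> = \<bar>(\<integral>x. g x \<partial>Q) - (\<integral>x. g x \<partial>gamma_dist shape alpha)\<bar>"
  \<comment> \<open>Two averages of width \<open>d\<close> move \<open>g\<close> by at most
    \<open>2 * d\<close> under each of the two laws, hence \<open>4 * d\<close>; the rest is the
    smooth bound with \<open>B1 = 1\<close> and \<open>B2 = 1 / d\<close>.\<close>
  have key: "\<Delta> \<le> 4 * d + K * (2 / d + 4 * alpha)" if d: "d > 0" for d
  proof -
    obtain h h' h'' where h: "\<And>x. (h has_real_derivative h' x) (at x)"
      "\<And>x. (h' has_real_derivative h'' x) (at x)" "continuous_on UNIV h''"
      "\<And>x. \<bar>h' x\<bar> \<le> 1" "\<And>x. \<bar>h'' x\<bar> \<le> 1 / d"
      and \<xi>: "\<And>x. \<exists>\<xi>. \<bar>\<xi> - x\<bar> < d + d \<and> h x = g \<xi>"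
      by (rule smooth_lipschitz[of g 1 d d]) (use g d in auto)
    have close: "\<bar>g x - h x\<bar> \<le> 2 * d" for x
    proof -
      obtain \<xi> where "\<bar>\<xi> - x\<bar> < d + d" "h x = g \<xi>" using \<xi> by blast
      with g[of x \<xi>] show ?thesis by (simp add: abs_minus_commute)
    qed
    have lip: "\<bar>h x - h y\<bar> \<le> 1 * \<bar>x - y\<bar>" for x y
      using field_differentiable_bound[of UNIV h h' 1 x y, OF convex_UNIV] h
      by (simp add: has_field_derivative_at_within)
    have g1: "\<bar>g x - g y\<bar> \<le> 1 * \<bar>x - y\<bar>" for x y using g by simp
    have smoothing: "\<bar>(\<integral>x. g x \<partial>N) - (\<integral>x. h x \<partial>N)\<bar> \<le> 2 * d"
      if "real_distribution N" "integrable N (\<lambda>x. x)" for N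
    proof -
      interpret N: real_distribution N by fact
      have i: "integrable N g" "integrable N h"
        by (rule N.integrable_lipschitz[OF that(2) g1], rule N.integrable_lipschitz[OF that(2) lip])
      have "\<bar>\<integral>x. g x - h x \<partial>N\<bar> \<le> 2 * d"
        by (rule order.trans[OF integral_abs_bound N.integral_le_const]) (use i close in auto)
      then show ?thesis using i by simp
    qed
    have "\<Delta> \<le> 4 * d + \<bar>(\<integral>x. h x \<partial>Q) - (\<integral>x. h x \<partial>gamma_dist shape alpha)\<bar>"
      using smoothing[OF Q.real_distribution_axioms integrable_Q_id]
        smoothing[OF G.real_distribution_axioms iG] unfolding \<Delta>_def by linarith
    also have "\<bar>(\<integral>x. h x \<partial>Q) - (\<integral>x. h x \<partial>gamma_dist shape alpha)\<bar> \<le> K * (2 * (1 / d) + 4 * alpha * 1)"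
      unfolding K_def by (rule smooth_test_bound[OF fin h]) auto
    finally show ?thesis by simp
  qed
  \<comment> \<open>The width is \<open>d = sqrt K\<close>, or arbitrarily small if
    \<open>K = 0\<close>. The stated constants follow from \<open>6 \<le> 8 * sqrt 3\<close> and
    \<open>4 \<le> 8\<close>.\<close>
  have "\<Delta> \<le> 6 * sqrt K + 4 * alpha * K"
  proof (cases "K = 0")
    case True
    have "\<Delta> \<le> 0 + e" if "e > 0" for e using key[of "e / 4"] that True by simp
    then have "\<Delta> \<le> 0" by (rule field_le_epsilon)
    then show ?thesis using True by simp
  next
    case False
    then have "sqrt K > 0" using K by simp
    moreover have "K * (2 / sqrt K) = 2 * sqrt K"
    proof -
      have "K * (2 / sqrt K) = 2 * (K / sqrt K)" by simp
      then show ?thesis unfolding real_div_sqrt[OF K] .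
    qed
    ultimately show ?thesis using key[of "sqrt K"] by (simp add: distrib_left mult_ac)
  qed
  also have "6 * sqrt K \<le> 8 * sqrt (3 * K)"
    using K by (intro mult_mono) auto
  also have "3 * K = (3 * (l * m) / (shape + 2)) * theta" by (simp add: K_def)
  also have "sqrt \<dots> = sqrt (3 * (l * m) / (shape + 2)) * theta powr (1/2)"
    by (simp only: real_sqrt_mult[of "3 * (l * m) / (shape + 2)"] powr_half_sqrt enn2real_nonneg)
  also have "4 * alpha * K = 4 * shape / (shape + 2) * theta"
    by (simp add: K_def shape_def alpha_def)
  also have "4 * shape / (shape + 2) * theta \<le> 8 * shape / (shape + 2) * theta"
    using parameters_pos by (intro mult_right_mono divide_right_mono) auto
  finally show ?thesis unfolding \<Delta>_def by (simp add: mult.assoc)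
qed

lemma kolmogorov_test_bound:
  assumes fin: "wasserstein_dist S (tilde_dist P) \<noteq> \<infinity>"
  shows "\<bar>cdf Q z - cdf (gamma_dist shape alpha) z\<bar>
    \<le> a_const (l * m) shape alpha * theta powr (min shape 1 / (min shape 1 + 2))
      + b_const (l * m) shape alpha * theta powr ((min shape 1 + 1) / (min shape 1 + 2))"
proof -
  interpret G: real_distribution "gamma_dist shape alpha"
    by (rule real_distribution_gamma_dist) (rule parameters_pos)+
  define D where "D = density_coeff shape alpha"
  define p where "p = min shape 1"
  have key: "\<bar>cdf Q z - cdf (gamma_dist shape alpha) z\<bar>
      \<le> D * \<epsilon> powr p / p + (l * m / (shape + 2)) * theta * (24 / \<epsilon>\<^sup>2 + 8 * alpha / \<epsilon>)"
    if e: "\<epsilon> > 0" for \<epsilon>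
  proof -
    define E where "E = (l * m / (shape + 2)) * theta * (24 / \<epsilon>\<^sup>2 + 8 * alpha / \<epsilon>)"
    have conc: "cdf (gamma_dist shape alpha) (u + \<epsilon>) - cdf (gamma_dist shape alpha) u \<le> D * \<epsilon> powr p / p" for u
      using gamma_dist_concentration[OF parameters_pos(2,1) e, of u] e
      by (simp add: G.cdf_diff_eq D_def p_def)
    have step: "cdf Q u \<le> cdf (gamma_dist shape alpha) (u + \<epsilon>) + E"
      "cdf (gamma_dist shape alpha) u \<le> cdf Q (u + \<epsilon>) + E" for u
    proof -
      obtain g g' g'' where g: "\<And>x. (g has_real_derivative g' x) (at x)"
        "\<And>x. (g' has_real_derivative g'' x) (at x)" "continuous_on UNIV g''"
        "\<And>x. \<bar>g' x\<bar> \<le> 2 / \<epsilon>" "\<And>x. \<bar>g'' x\<bar> \<le> 12 / \<epsilon>\<^sup>2"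
        and g01: "\<And>x. 0 \<le> g x" "\<And>x. g x \<le> 1" "\<And>x. x \<le> u \<Longrightarrow> g x = 1" "\<And>x. u + \<epsilon> \<le> x \<Longrightarrow> g x = 0"
        using smooth_indicator[OF e, of u] by blast
      have "continuous_on UNIV g" by (rule DERIV_continuous_on) (rule has_field_derivative_at_within[OF g(1)])
      then have gm: "g \<in> borel_measurable borel" by (rule borel_measurable_continuous_onI)
      have "\<bar>(\<integral>x. g x \<partial>Q) - (\<integral>x. g x \<partial>gamma_dist shape alpha)\<bar>
         \<le> l * m / (shape + 2) * theta * (2 * (12 / \<epsilon>\<^sup>2) + 4 * alpha * (2 / \<epsilon>))"
        by (rule smooth_test_bound[OF fin g]) (use e in auto)
      then have "\<bar>(\<integral>x. g x \<partial>Q) - (\<integral>x. g x \<partial>gamma_dist shape alpha)\<bar> \<le> E"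
        by (simp add: E_def mult_ac)
      moreover have "cdf N u \<le> (\<integral>x. g x \<partial>N)" "(\<integral>x. g x \<partial>N) \<le> cdf N (u + \<epsilon>)"
        if "real_distribution N" for N
        by (rule cdf_smooth_indicator[OF that gm]; use g01 in auto)+
      note this[OF Q.real_distribution_axioms] this[OF G.real_distribution_axioms]
      ultimately show "cdf Q u \<le> cdf (gamma_dist shape alpha) (u + \<epsilon>) + E"
        "cdf (gamma_dist shape alpha) u \<le> cdf Q (u + \<epsilon>) + E" by linarith+
    qed
    \<comment> \<open>One side compares \<open>z\<close> with \<open>z + \<epsilon>\<close>, the
      other \<open>z - \<epsilon>\<close> with \<open>z\<close>, so that the increment over the
      smoothing window is always one of the gamma law; the compound law has atoms.\<close>
    show ?thesis
      using step(1)[of z] step(2)[of "z - \<epsilon>"] conc[of z] conc[of "z - \<epsilon>"]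
      unfolding E_def[symmetric] by simp
  qed
  show ?thesis
    unfolding a_const_eq[OF parameters_pos(2,1,3)] b_const_eq[OF parameters_pos(2,1,3)]
      D_def[symmetric] p_def[symmetric]
    by (rule optimise_smoothing[OF _ _ _ _ key])
       (use parameters_pos density_coeff_pos in \<open>auto simp: p_def D_def\<close>)
qed

end

lemma wasserstein_dist_le:
  assumes "integrable P (\<lambda>x. x)" "integrable Q (\<lambda>x. x)"
    and "\<And>f. (\<And>x y. \<bar>f x - f y\<bar> \<le> \<bar>x - y\<bar>) \<Longrightarrow> \<bar>(\<integral>x. f x \<partial>P) - (\<integral>x. f x \<partial>Q)\<bar> \<le> b"
  shows "wasserstein_dist P Q \<le> ennreal b"
  unfolding wasserstein_dist_def using assms by (auto intro!: SUP_least ennreal_leI)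

theorem proposition4p3:
  fixes M :: "'a measure" and X :: "'a \<Rightarrow> real"
    and N :: "'b measure" and W :: "'b \<Rightarrow> real"
    and Xs_law Xz_law :: "real measure"
    and l \<mu> \<sigma>2 \<alpha> r :: real and \<theta> :: ennreal
  assumes "prob_space M" and "X \<in> borel_measurable M"
    and "AE \<omega> in M. 0 \<le> X \<omega>"
    and "integrable M (\<lambda>\<omega>. (X \<omega>)\<^sup>2)" and "0 < prob_space.variance M X"
    and "size_biased (distr M borel X) Xs_law"
    and "zero_biased (distr M borel X) Xz_law"
    and "0 < l"
    and "prob_space N" and "W \<in> borel_measurable N"
    and "distr N borel W = compound_poisson l (distr M borel X)"
    and "\<mu> = prob_space.expectation N W"
    and "\<sigma>2 = prob_space.variance N W"
    and "\<alpha> = \<mu> / \<sigma>2"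
    and "r = \<mu>\<^sup>2 / \<sigma>2"
    and "\<theta> = wasserstein_dist Xs_law (tilde_dist (distr M borel X))"
  shows "wasserstein_dist (distr N borel W) (gamma_dist r \<alpha>)
           \<le> ennreal (8 * sqrt (3 * \<mu> / (r + 2))) * ennreal_powr \<theta> (1/2)
              + ennreal (8 * r / (r + 2)) * \<theta>
       \<and> kolmogorov_dist (distr N borel W) (gamma_dist r \<alpha>)
           \<le> ennreal (a_const \<mu> r \<alpha>) * ennreal_powr \<theta> (min r 1 / (min r 1 + 2))
              + ennreal (b_const \<mu> r \<alpha>) * ennreal_powr \<theta> ((min r 1 + 1) / (min r 1 + 2))"
proof -
  interpret M: prob_space M by fact
  note [measurable] = assms(2,10)
  define P where "P = distr M borel X"
  interpret P: prob_space P unfolding P_def by (rule M.prob_space_distr) simp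
  interpret compound_poisson_law P Xs_law l
  proof unfold_locales
    show "AE x in P. 0 \<le> x" unfolding P_def using assms(3) by (simp add: AE_distr_iff)
    show "integrable P (\<lambda>x. x\<^sup>2)" unfolding P_def using assms(4) by (simp add: integrable_distr_eq)
    show "0 < P.variance (\<lambda>x. x)" unfolding P_def using assms(5) by (simp add: integral_distr)
  qed (use assms(6,8) in \<open>auto simp: P_def\<close>)
  have W: "distr N borel W = Q" using assms(11) by (simp add: P_def)
  have \<mu>: "\<mu> = l * m"
    using expectation_Q unfolding W[symmetric] assms(12) by (simp add: integral_distr)
  have \<sigma>2: "\<sigma>2 = l * m * mS"
    using variance_Q unfolding W[symmetric] assms(13) by (simp add: integral_distr)
  have \<alpha>: "\<alpha> = alpha" using parameters_pos mS_pos l_pos m_pos by (simp add: assms(14) \<mu> \<sigma>2 alpha_def)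
  have r: "r = shape" using parameters_pos mS_pos l_pos m_pos
    by (simp add: assms(15) \<mu> \<sigma>2 shape_def power2_eq_square)
  have \<theta>: "\<theta> = wasserstein_dist Xs_law (tilde_dist P)" by (simp add: assms(16) P_def)
  have pos: "r > 0" "\<alpha> > 0" "\<mu> > 0" using parameters_pos by (auto simp: r \<alpha> \<mu>)
  \<comment> \<open>Strict positivity matters when \<open>\<theta> = \<infinity>\<close>: since
    \<open>0 * \<infinity> = 0\<close> for extended reals, only positive coefficients make the
    right-hand sides infinite.\<close>
  have a: "a_const \<mu> r \<alpha> > 0" "b_const \<mu> r \<alpha> > 0"
    using pos density_coeff_pos[OF pos(1,2)]
    by (auto simp: a_const_eq b_const_eq intro!: mult_pos_pos add_pos_pos)
  show ?thesis
  proof (cases "\<theta> = \<infinity>")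
    case True
    then show ?thesis using a pos by (simp add: ennreal_powr_def ennreal_mult_top)
  next
    case False
    then have fin: "wasserstein_dist Xs_law (tilde_dist P) \<noteq> \<infinity>" by (simp add: \<theta>)
    have \<theta>': "\<theta> = ennreal theta" using False ennreal_enn2real[of \<theta>] by (simp add: \<theta> less_top)
    have powr: "ennreal_powr \<theta> p = ennreal (theta powr p)" for p
      using False by (simp add: ennreal_powr_def \<theta>)
    have "wasserstein_dist Q (gamma_dist r \<alpha>) \<le>
      ennreal (8 * sqrt (3 * \<mu> / (r + 2)) * theta powr (1/2) + 8 * r / (r + 2) * theta)"
      unfolding r \<alpha> \<mu>
      by (rule wasserstein_dist_le[OF integrable_Q_id integrable_gamma_dist_id[OF parameters_pos(2,1)]])
         (rule wasserstein_test_bound[OF fin])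
    moreover have "kolmogorov_dist Q (gamma_dist r \<alpha>) \<le>
      ennreal (a_const \<mu> r \<alpha> * theta powr (min r 1 / (min r 1 + 2))
        + b_const \<mu> r \<alpha> * theta powr ((min r 1 + 1) / (min r 1 + 2)))"
      unfolding kolmogorov_dist_def r \<alpha> \<mu>
      by (intro SUP_least ennreal_leI kolmogorov_test_bound[OF fin])
    moreover have lin: "ennreal c * ennreal x + ennreal d * ennreal y = ennreal (c * x + d * y)"
      if "0 \<le> c" "0 \<le> x" "0 \<le> d" "0 \<le> y" for c x d y
      using that by (simp add: ennreal_mult ennreal_plus)
    have "ennreal (8 * sqrt (3 * \<mu> / (r + 2))) * ennreal_powr \<theta> (1/2) + ennreal (8 * r / (r + 2)) * \<theta> =
      ennreal (8 * sqrt (3 * \<mu> / (r + 2)) * theta powr (1/2) + 8 * r / (r + 2) * theta)"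
      unfolding powr by (subst \<theta>', rule lin) (use pos in auto)
    moreover have "ennreal (a_const \<mu> r \<alpha>) * ennreal_powr \<theta> (min r 1 / (min r 1 + 2))
        + ennreal (b_const \<mu> r \<alpha>) * ennreal_powr \<theta> ((min r 1 + 1) / (min r 1 + 2)) =
      ennreal (a_const \<mu> r \<alpha> * theta powr (min r 1 / (min r 1 + 2))
        + b_const \<mu> r \<alpha> * theta powr ((min r 1 + 1) / (min r 1 + 2)))"
      unfolding powr by (rule lin) (use a in auto)
    ultimately show ?thesis unfolding W by simp
  qed
qed

end
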